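(* Let $n\ge2$, let $I\subset\mathbb{R}$ be measurable, and let $k_1,\dots,k_n$ be bounded measurable functions on $I\times\mathbb{R}^+$ such that the operators $(K_if)(\lambda)=\int_{\mathbb{R}^+}k_i(\lambda,x)f(x)\,dx$ satisfy $\|K_if\|_{L^2(I)}\le C_i\|f\|_{L^2(\mathbb{R}^+)}$ on functions of compact support. Let $A$ be any set of ordered pairs $\alpha=(i_\alpha,i'_\alpha)$ with $1\le i_\alpha,i'_\alpha\le n$. Then for any $1\le p<2$ and any functions $f_1,\dots,f_n\in L^p(\mathbb{R}^+)$, the operator $T_n$ converges on $f_1,\dots,f_n$ for almost every $\lambda\in I$; that is, for almost every $\lambda\in I$ there exists a number $T_n^{\infty,\dots,\infty}(f_1,\dots,f_n)(\lambda)$ such that for any $\delta>0$ there exists $N_\delta$ such that whenever $\min_iD_i\ge N_\delta$, \[ \left|T_n^{\infty,\dots,\infty}(f_1,\dots,f_n)(\lambda)-T_n^{D_1,\dots,D_n}(f_1,\dots,f_n)(\lambda)\right|<\delta. \]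
   Context: $\mathbb{R}^+=(0,\infty)$ and $\chi_E$ is the characteristic function of $E$. For $D_1,\dots,D_n\in(0,\infty)$, \[ T_n^{D_1,\dots,D_n}(f_1,\dots,f_n)(\lambda)=\int_{(\mathbb{R}^+)^n}\prod_{j=1}^{n}f_j(x_j)\,k_j(\lambda,x_j)\,\chi_{\mathbb{R}^+}(D_j-x_j)\prod_{\alpha\in A}\chi_{\mathbb{R}^+}(x_{i_\alpha}-x_{i'_\alpha})\,dx_1\cdots dx_n. \] *)

theory Defs
  imports "HOL-Analysis.Analysis"
begin

definition Lp_space :: "real \<Rightarrow> real set \<Rightarrow> (real \<Rightarrow> complex) set" where
  "Lp_space p S =
     {f. f \<in> borel_measurable (lebesgue_on S) \<and>
         integrable (lebesgue_on S) (\<lambda>x. norm (f x) powr p)}"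

text \<open>Meaningful only for members of \<^const>\<open>Lp_space\<close>: for a function whose \<open>p\<close>-th power
  is not integrable the Bochner integral is \<open>0\<close>.\<close>

definition Lp_norm :: "real \<Rightarrow> real set \<Rightarrow> (real \<Rightarrow> complex) \<Rightarrow> real" where
  "Lp_norm p S f = (LINT x|lebesgue_on S. norm (f x) powr p) powr (1 / p)"

text \<open>The support is compact as a subset of \<open>S\<close>; for \<open>S = (0, \<infinity>)\<close> it therefore stays
  away from \<open>0\<close> as well as from infinity.\<close>

definition compactly_supported_in :: "real set \<Rightarrow> (real \<Rightarrow> complex) \<Rightarrow> bool" where
  "compactly_supported_in S f \<longleftrightarrow> (\<exists>K. compact K \<and> K \<subseteq> S \<and> (\<forall>x\<in>S - K. f x = 0))"

definition kernel_op :: "(real \<Rightarrow> real \<Rightarrow> complex) \<Rightarrow> (real \<Rightarrow> complex) \<Rightarrow> real \<Rightarrow> complex" where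
  "kernel_op \<kappa> f l = (LINT x|lebesgue_on {0<..}. \<kappa> l x * f x)"

text \<open>The product measure is not completed. This does not affect the integral: for almost
  every \<open>l\<close> the integrand is a finite product of functions of single coordinates that are
  Lebesgue measurable and of indicators of Borel sets, hence measurable for the product
  \<open>\<sigma>\<close>-algebra. For bounded kernels and \<open>f j\<close> in \<open>L\<^sup>p\<close>, \<open>p \<ge> 1\<close>, the cut-offs
  \<open>x j < D j\<close> make it absolutely integrable.\<close>

definition multilinear_op ::
  "nat \<Rightarrow> (nat \<times> nat) set \<Rightarrow> (nat \<Rightarrow> real \<Rightarrow> real \<Rightarrow> complex) \<Rightarrow>
   (nat \<Rightarrow> real) \<Rightarrow> (nat \<Rightarrow> real \<Rightarrow> complex) \<Rightarrow> real \<Rightarrow> complex" where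
  "multilinear_op n A k D f l =
     (LINT x|PiM {1..n} (\<lambda>_. lebesgue_on {0<..}).
        (\<Prod>j\<in>{1..n}. f j (x j) * k j l (x j) * indicator {0<..} (D j - x j)) *
        (\<Prod>(i, i')\<in>A. indicator {0<..} (x i - x i')))"

end

theory Submission
  imports Defs "HOL-Analysis.Radon_Nikodym"
begin

text \<open>
  Up to a null set the coordinates are distinct and hence linearly ordered, so the operator is a
  finite sum of iterated integrals along chains. For fixed \<open>l\<close> such an integral is estimated by
  Young's theory: if the increments of all the primitives \<open>\<integral> f i k i\<close> over \<open>[s, t)\<close> are at most
  \<open>\<omega>(s, t) powr q\<close> with \<open>\<omega>\<close> superadditive, bounded and \<open>q > 1/2\<close>, then the iterated integrals obey
  multilinear bounds in terms of \<open>\<omega>\<close>, and since \<open>\<omega>(N, \<infinity>)\<close> tends to \<open>0\<close> they are Cauchy in the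
  cut-offs. The control \<open>\<omega>\<close> is found for almost every \<open>l\<close>, with any \<open>1/2 < q < 1/p\<close>, by cutting the
  half line into dyadic cells of equal mass for \<open>|f|\<^sup>p\<close> plus a positive integrable weight: on each
  cell the large values of \<open>f\<close> are treated trivially in \<open>L\<^sup>1\<close> and the small ones by the \<open>L\<^sup>2\<close>
  bound, and the resulting square sums over all cells and scales have finite integral over \<open>I\<close>.
\<close>

section \<open>Young's estimate\<close>

text \<open>The exceptional set of \<open>l\<close> must not depend on the cut-offs, which range
  over a continuum. The almost everywhere argument is therefore confined to one bound for the
  increments over all intervals at once; everything built on that bound is deterministic, with
  \<open>l\<close> fixed.

  The exponent is squeezed from two sides. Halving a control gains \<open>2 powr (2*q)\<close> on a
  product of two increments, against the 2 halves that have to be added: this needs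
  \<open>q > 1/2\<close>. On the cells of level \<open>m\<close> the increments have size about
  \<open>2 powr (-m/p)\<close>, while the weight \<open>\<alpha> ^ m\<close> must stay summable over
  \<open>2 ^ m\<close> cells, so \<open>\<alpha> < 1/2\<close>: the two are compatible only for
  \<open>q < 1/p\<close>. There is room between the bounds exactly when \<open>p < 2\<close>.

  For \<open>p > 1\<close> the function \<open>f i * k i l\<close> need not be integrable on the
  whole half line. Iterated integrals are therefore formed only from cut functions, and their
  convergence comes from the smallness of the control far out, not from dominated
  convergence.\<close>

lemma discrete_young:
  fixes X Y :: "nat \<Rightarrow> complex" and \<omega> :: "nat \<Rightarrow> nat \<Rightarrow> real"
  assumes nonneg: "\<And>i j. i \<le> j \<Longrightarrow> 0 \<le> \<omega> i j"
    and super: "\<And>i j k. i \<le> j \<Longrightarrow> j \<le> k \<Longrightarrow> \<omega> i j + \<omega> j k \<le> \<omega> i k"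
    and X: "\<And>i j. i \<le> j \<Longrightarrow> norm (X j - X i) \<le> a * \<omega> i j powr q"
    and Y: "\<And>i j. i \<le> j \<Longrightarrow> norm (Y j - Y i) \<le> b * \<omega> i j powr q"
    and ab: "0 \<le> a" "0 \<le> b" and q: "1/2 < q" and "i \<le> j"
  shows "norm (\<Sum>l\<in>{i..<j}. (Y l - Y i) * (X (Suc l) - X l))
           \<le> 2 / (1 - 2 powr (1 - 2*q)) * (a * b) * \<omega> i j powr (2*q)"
  using \<open>i \<le> j\<close>
proof (induction "j - i" arbitrary: i j rule: less_induct)
  case less
  \<comment> \<open>\<open>c\<close> is the fixed point of the recursion below. In units of
    \<open>a * b * w powr (2*q)\<close> the two halves cost \<open>c * 2 powr (1 - 2*q)\<close>
    together and the two cross terms cost 1 each.\<close>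
  define c where "c = 2 / (1 - 2 powr (1 - 2*q))"
  have "(2::real) powr (1 - 2*q) < 2 powr 0" using q by (intro powr_less_mono) auto
  hence c: "c \<ge> 0" and ceq: "c * 2 powr (1 - 2*q) + 2 = c"
    by (auto simp: c_def divide_simps)
  have diag: "\<omega> k k = 0" for k using super[of k k k] nonneg[of k k] by simp
  show ?case
  proof (cases "i = j")
    case True then show ?thesis using ab c by (simp add: diag)
  next
    case False
    \<comment> \<open>\<open>Max S\<close> is the last index up to which at most half of the control
      is spent. One step further more than half is spent, so superadditivity leaves at most half
      beyond \<open>Suc m\<close>.\<close>
    define S where "S = {m\<in>{i..<j}. \<omega> i m \<le> \<omega> i j / 2}"
    have "i \<in> S" using False less.prems nonneg[of i j] by (auto simp: S_def diag)
    moreover have fS: "finite S" by (auto simp: S_def)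
    ultimately have mS: "Max S \<in> S" by (intro Max_in) auto
    define m where "m = Max S"
    have m: "i \<le> m" "m < j" "\<omega> i m \<le> \<omega> i j / 2" using mS by (auto simp: S_def m_def)
    have m2: "\<omega> (Suc m) j \<le> \<omega> i j / 2"
    proof (cases "Suc m = j")
      case True then show ?thesis using nonneg[of i j] less.prems by (simp add: diag)
    next
      case F: False
      have "Suc m \<notin> S" using Max_ge[OF fS, of "Suc m"] by (auto simp: m_def)
      then have "\<omega> i (Suc m) > \<omega> i j / 2" using F m by (auto simp: S_def)
      then show ?thesis using super[of i "Suc m" j] m by simp
    qed
    define w where "w = \<omega> i j"
    have w0: "0 \<le> w" using nonneg less.prems by (simp add: w_def)
    have mono: "\<omega> u v \<le> w" if "i \<le> u" "u \<le> v" "v \<le> j" for u v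
      using super[of i u v] super[of i v j] nonneg[of i u] nonneg[of v j] that by (simp add: w_def)
    have cross: "norm ((Y u - Y i) * (X v' - X v)) \<le> a * b * w powr (2*q)"
      if "i \<le> u" "u \<le> j" "i \<le> v" "v \<le> v'" "v' \<le> j" for u v v'
    proof -
      have "norm (Y u - Y i) \<le> b * w powr q"
        using that ab q by (intro order.trans[OF Y] mult_left_mono powr_mono2 mono nonneg) auto
      moreover have "norm (X v' - X v) \<le> a * w powr q"
        using that ab q by (intro order.trans[OF X] mult_left_mono powr_mono2 mono nonneg) auto
      ultimately have "norm ((Y u - Y i) * (X v' - X v)) \<le> (b * w powr q) * (a * w powr q)"
        unfolding norm_mult using ab by (intro mult_mono) auto
      also have "\<dots> = a * b * w powr (2*q)" by (simp add: powr_add[of w q q, folded mult_2])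
      finally show ?thesis .
    qed
    have half: "c * (a*b) * \<omega> u v powr (2*q) \<le> c * (a*b) * (w powr (2*q) * 2 powr (-2*q))"
      if "u \<le> v" "\<omega> u v \<le> w / 2" for u v
    proof -
      have "\<omega> u v powr (2*q) \<le> (w/2) powr (2*q)"
        using that nonneg[of u v] q by (intro powr_mono2) auto
      also have "\<dots> = w powr (2*q) * 2 powr (-2*q)"
        using w0 by (simp add: powr_divide powr_minus field_simps)
      finally show ?thesis using c ab by (intro mult_left_mono) auto
    qed
    let ?f = "\<lambda>l. (Y l - Y i) * (X (Suc l) - X l)"
    have e1: "(\<Sum>l\<in>{i..<j}. ?f l) = (\<Sum>l\<in>{i..<m}. ?f l) + (?f m + (\<Sum>l\<in>{Suc m..<j}. ?f l))"
      using m by (simp add: sum.atLeastLessThan_concat[of i m j, symmetric] sum.atLeast_Suc_lessThan[of m j])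
    \<comment> \<open>Re-basing the right block at \<open>Suc m\<close> puts it in the form of the
      induction hypothesis. The price is one product of two increments, a cross term like
      \<open>?f m\<close>.\<close>
    have "(\<Sum>l\<in>{Suc m..<j}. ?f l) = (\<Sum>l\<in>{Suc m..<j}. (Y l - Y (Suc m)) * (X (Suc l) - X l))
            + (Y (Suc m) - Y i) * (\<Sum>l\<in>{Suc m..<j}. X (Suc l) - X l)"
      by (simp add: sum_distrib_left sum.distrib[symmetric] algebra_simps)
    also have "(\<Sum>l\<in>{Suc m..<j}. X (Suc l) - X l) = X j - X (Suc m)"
      using m by (intro sum_Suc_diff') auto
    finally have e2: "(\<Sum>l\<in>{Suc m..<j}. ?f l) = (\<Sum>l\<in>{Suc m..<j}. (Y l - Y (Suc m)) * (X (Suc l) - X l))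
            + (Y (Suc m) - Y i) * (X j - X (Suc m))" .
    have i1: "norm (\<Sum>l\<in>{i..<m}. ?f l) \<le> c * (a*b) * \<omega> i m powr (2*q)"
      unfolding c_def using m by (intro less.hyps) auto
    have i2: "norm (\<Sum>l\<in>{Suc m..<j}. (Y l - Y (Suc m)) * (X (Suc l) - X l)) \<le> c * (a*b) * \<omega> (Suc m) j powr (2*q)"
      unfolding c_def using m by (intro less.hyps) auto
    have "norm (\<Sum>l\<in>{i..<j}. ?f l) \<le> c * (a*b) * (w powr (2*q) * 2 powr (-2*q)) + a*b*w powr (2*q)
           + (c * (a*b) * (w powr (2*q) * 2 powr (-2*q)) + a*b*w powr (2*q))"
    proof -
      have tri: "norm (u1 + (u2 + (u3 + u4))) \<le> P + Q + (P + Q)"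
        if "norm u1 \<le> P" "norm u2 \<le> Q" "norm u3 \<le> P" "norm u4 \<le> Q" for u1 u2 u3 u4 :: complex and P Q
        using that norm_triangle_ineq[of u1 "u2 + (u3 + u4)"] norm_triangle_ineq[of u2 "u3 + u4"]
          norm_triangle_ineq[of u3 u4] by linarith
      show ?thesis
        unfolding e1 e2
        by (rule tri[OF order.trans[OF i1 half] cross order.trans[OF i2 half] cross]) (use m m2 in \<open>auto simp: w_def\<close>)
    qed
    also have "\<dots> = (c * (2 * 2 powr (-2*q)) + 2) * ((a*b) * w powr (2*q))"
      by algebra
    also have "2 * (2::real) powr (-2*q) = 2 powr (1 - 2*q)"
      using powr_add[of "2::real" 1 "-2*q"] by simp
    also have "c * 2 powr (1 - 2*q) + 2 = c" by (rule ceq)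
    finally show ?thesis by (simp only: c_def w_def mult.assoc)
  qed
qed

section \<open>Increments of primitives on the half line\<close>

abbreviation halfline :: "real measure" where
  "halfline \<equiv> lebesgue_on {0<..}"

text \<open>This is not the oriented integral: for \<open>t \<le> s\<close> the value is 0. Cut-offs
  can therefore be moved into the endpoints by \<open>min\<close> and \<open>max\<close> without
  case distinctions.\<close>

definition incr :: "(real \<Rightarrow> 'a::{banach,second_countable_topology}) \<Rightarrow> real \<Rightarrow> real \<Rightarrow> 'a" where
  "incr g s t = (LINT x:{s..<t}|halfline. g x)"

lemma sigma_finite_lebesgue_on:
  assumes "S \<in> sets (lebesgue :: 'a::euclidean_space measure)"
  shows "sigma_finite_measure (lebesgue_on S)"
proof -
  obtain A :: "nat \<Rightarrow> 'a set" where A: "range A \<subseteq> sets lborel" "(\<Union>i. A i) = space lborel"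
      "\<And>i. emeasure lborel (A i) \<noteq> \<infinity>"
    using lborel.sigma_finite by blast
  have "sigma_finite_measure (lebesgue :: 'a measure)"
  proof
    show "\<exists>B. countable B \<and> B \<subseteq> sets lebesgue \<and> \<Union> B = space (lebesgue::'a measure) \<and> (\<forall>a\<in>B. emeasure lebesgue a \<noteq> \<infinity>)"
      using A by (intro exI[of _ "range A"]) (auto simp: image_subset_iff)
  qed
  then show ?thesis
    by (rule sigma_finite_measure_restrict_space) (use assms in auto)
qed

lemma measurable_halfline:
  "f \<in> borel_measurable borel \<Longrightarrow> f \<in> borel_measurable halfline"
  by (intro measurable_restrict_space1 measurable_completion) simp

lemma sets_halfline: "A \<in> sets borel \<Longrightarrow> A \<inter> {0<..} \<in> sets halfline"
  by (auto simp: sets_restrict_space)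

lemma indicator_measurable_halfline:
  "A \<in> sets borel \<Longrightarrow> indicator A \<in> borel_measurable halfline"
  by (intro measurable_halfline) auto

lemma AE_halfline_neq: "AE x in halfline. x \<noteq> c"
proof -
  have "AE x in lebesgue. x \<noteq> c"
    by (intro AE_completion AE_lborel_singleton)
  then show ?thesis by (auto simp: AE_restrict_space_iff elim: eventually_mono)
qed

lemma integrable_halfline_indicator:
  fixes g :: "real \<Rightarrow> 'a::{banach,second_countable_topology}"
  assumes "integrable halfline g" "A \<in> sets borel"
  shows "integrable halfline (\<lambda>x. indicator A x *\<^sub>R g x)"
proof -
  have [measurable]: "g \<in> borel_measurable halfline" using assms by auto
  show ?thesis
  proof (rule Bochner_Integration.integrable_bound[OF assms(1)])
    show "(\<lambda>x. indicator A x *\<^sub>R g x) \<in> borel_measurable halfline"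
      by (intro borel_measurable_scaleR indicator_measurable_halfline assms) measurable
  qed (auto simp: indicator_def)
qed

lemma incr_empty [simp]: "t \<le> s \<Longrightarrow> incr g s t = 0"
  by (simp add: incr_def set_lebesgue_integral_def)

lemma incr_split:
  assumes g: "integrable halfline g" and "s \<le> u" "u \<le> t"
  shows "incr g s t = incr g s u + incr g u t"
proof -
  have "incr g s u + incr g u t
     = (\<integral>x. indicator {s..<u} x *\<^sub>R g x + indicator {u..<t} x *\<^sub>R g x \<partial>halfline)"
    unfolding incr_def set_lebesgue_integral_def
    by (intro Bochner_Integration.integral_add[symmetric] integrable_halfline_indicator g) auto
  also have "\<dots> = incr g s t"
    unfolding incr_def set_lebesgue_integral_def using assms(2,3)
    by (intro Bochner_Integration.integral_cong) (auto simp: indicator_def)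
  finally show ?thesis by simp
qed

lemma incr_minus:
  assumes "integrable halfline g" "integrable halfline h"
  shows "incr (\<lambda>x. g x - h x) s t = incr g s t - incr h s t"
  unfolding incr_def set_lebesgue_integral_def
  by (subst Bochner_Integration.integral_diff[symmetric])
     (auto intro!: integrable_halfline_indicator assms simp: scaleR_diff_right)

lemma incr_add:
  assumes "integrable halfline g" "integrable halfline h"
  shows "incr (\<lambda>x. g x + h x) s t = incr g s t + incr h s t"
  unfolding incr_def set_lebesgue_integral_def
  by (subst Bochner_Integration.integral_add[symmetric])
     (auto intro!: integrable_halfline_indicator assms simp: scaleR_add_right)

lemma continuous_incr:
  assumes g: "integrable halfline g"
  shows "continuous_on UNIV (\<lambda>t. incr g s t)"
proof (rule continuous_at_imp_continuous_on, intro ballI)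
  fix t
  have [measurable]: "g \<in> borel_measurable halfline" using assms by auto
  show "isCont (\<lambda>t. incr g s t) t"
  proof (rule continuous_at_sequentiallyI)
    fix u assume u: "u \<longlonglongrightarrow> t"
    show "(\<lambda>n. incr g s (u n)) \<longlonglongrightarrow> incr g s t"
      unfolding incr_def set_lebesgue_integral_def
    proof (rule integral_dominated_convergence[where w="\<lambda>x. norm (g x)"])
      show "AE x in halfline. (\<lambda>n. indicator {s..<u n} x *\<^sub>R g x) \<longlonglongrightarrow> indicator {s..<t} x *\<^sub>R g x"
        using AE_halfline_neq[of t]
      proof eventually_elim
        case (elim x)
        have "eventually (\<lambda>n. (x < u n) = (x < t)) sequentially"
        proof (cases "x < t")
          case True
          then show ?thesis using order_tendstoD(1)[OF u True] by (auto elim: eventually_mono)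
        next
          case False
          then have "t < x" using elim by simp
          then show ?thesis using order_tendstoD(2)[OF u \<open>t < x\<close>] by (auto elim: eventually_mono)
        qed
        then have "eventually (\<lambda>n. indicator {s..<u n} x *\<^sub>R g x = indicator {s..<t} x *\<^sub>R g x) sequentially"
          by eventually_elim (auto simp: indicator_def)
        then show ?case by (rule tendsto_eventually)
      qed
      show "AE x in halfline. norm (indicator {s..<u n} x *\<^sub>R g x) \<le> norm (g x)" for n
        by (auto simp: indicator_def)
    qed (intro borel_measurable_integrable integrable_halfline_indicator integrable_norm g; simp)+
  qed
qed

lemma norm_incr_le:
  assumes g: "integrable halfline g" and h: "integrable halfline h"
    and le: "\<And>x. s \<le> x \<Longrightarrow> x < t \<Longrightarrow> x > 0 \<Longrightarrow> norm (g x) \<le> h x"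
  shows "norm (incr g s t) \<le> incr h s t"
  unfolding incr_def set_lebesgue_integral_def
proof (rule order.trans[OF integral_norm_bound integral_mono])
  show "norm (indicator {s..<t} x *\<^sub>R g x) \<le> indicator {s..<t} x *\<^sub>R h x" if "x \<in> space halfline" for x
    using le[of x] that by (auto simp: indicator_def space_restrict_space)
qed (intro integrable_halfline_indicator assms integrable_norm; simp)+

lemma continuous_on_measurable_halfline:
  fixes h :: "real \<Rightarrow> complex"
  assumes "continuous_on {0..} h"
  shows "h \<in> borel_measurable halfline"
proof -
  have "(\<lambda>x. indicator {0..} x *\<^sub>R h x) \<in> borel_measurable halfline"
    by (intro measurable_halfline borel_measurable_continuous_on_indicator assms) auto
  then show ?thesis
    by (rule measurable_cong[THEN iffD1, rotated]) (auto simp: space_restrict_space)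
qed

lemma integrable_halfline_mult:
  fixes g h :: "real \<Rightarrow> complex"
  assumes g: "integrable halfline g" and h: "continuous_on {0..} h"
    and B: "\<And>x. x \<ge> 0 \<Longrightarrow> norm (h x) \<le> B"
  shows "integrable halfline (\<lambda>x. g x * h x)"
proof -
  have [measurable]: "g \<in> borel_measurable halfline" "h \<in> borel_measurable halfline"
    using g continuous_on_measurable_halfline[OF h] by auto
  show ?thesis
  proof (rule Bochner_Integration.integrable_bound)
    show "integrable halfline (\<lambda>x. B *\<^sub>R norm (g x))" using g by simp
    show "AE x in halfline. norm (g x * h x) \<le> norm (B *\<^sub>R norm (g x))"
    proof (rule AE_I2)
      fix x assume "x \<in> space halfline"
      then have "norm (h x) \<le> \<bar>B\<bar>" using B[of x] by (auto simp: space_restrict_space)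
      then show "norm (g x * h x) \<le> norm (B *\<^sub>R norm (g x))"
        by (auto simp: norm_mult abs_mult mult.commute[of "norm (g x)"] intro!: mult_right_mono)
    qed
  qed auto
qed

lemma incr_sum:
  assumes "integrable halfline g" "\<And>i. \<tau> i \<le> \<tau> (Suc i)"
  shows "incr g (\<tau> 0) (\<tau> N) = (\<Sum>i<N. incr g (\<tau> i) (\<tau> (Suc i)))"
proof (induction N)
  case (Suc N)
  have "\<tau> 0 \<le> \<tau> N" using assms(2) by (simp add: lift_Suc_mono_le)
  then show ?case using incr_split[OF assms(1), of "\<tau> 0" "\<tau> N" "\<tau> (Suc N)"] Suc assms(2) by simp
qed simp

text \<open>The discrete estimate is uniform over partitions, so it survives refinement of the mesh.
  Replacing the integral by its left-endpoint sum costs \<open>\<epsilon>\<close> times the L1 norm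
  of \<open>g\<close>, by uniform continuity of \<open>h\<close>. That norm enters only the
  vanishing error; the final bound sees \<open>g\<close> through its increments alone.\<close>

lemma young_step:
  fixes g h :: "real \<Rightarrow> complex" and \<omega> :: "real \<Rightarrow> real \<Rightarrow> real"
  assumes nonneg: "\<And>s t. 0 \<le> s \<Longrightarrow> s \<le> t \<Longrightarrow> 0 \<le> \<omega> s t"
    and super: "\<And>s u t. 0 \<le> s \<Longrightarrow> s \<le> u \<Longrightarrow> u \<le> t \<Longrightarrow> \<omega> s u + \<omega> u t \<le> \<omega> s t"
    and g: "integrable halfline g" and h: "continuous_on {0..} h"
    and B: "\<And>x. x \<ge> 0 \<Longrightarrow> norm (h x) \<le> B"
    and G: "\<And>s t. 0 \<le> s \<Longrightarrow> s \<le> t \<Longrightarrow> norm (incr g s t) \<le> a * \<omega> s t powr q"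
    and H: "\<And>s t. 0 \<le> s \<Longrightarrow> s \<le> t \<Longrightarrow> norm (h t - h s) \<le> b * \<omega> s t powr q"
    and ab: "0 \<le> a" "0 \<le> b" and q: "1/2 < q" and st: "0 \<le> s" "s \<le> t"
  shows "norm (incr (\<lambda>x. g x * h x) s t - h s * incr g s t)
           \<le> 2 / (1 - 2 powr (1 - 2*q)) * (a * b) * \<omega> s t powr (2*q)"
proof (rule field_le_epsilon)
  fix e :: real assume "e > 0"
  define Z where "Z = incr (\<lambda>x. norm (g x)) s t"
  have ng: "integrable halfline (\<lambda>x. norm (g x))" using g by simp
  have gh: "integrable halfline (\<lambda>x. g x * h x)" by (rule integrable_halfline_mult[OF g h B])
  have Z: "Z \<ge> 0" unfolding Z_def incr_def set_lebesgue_integral_def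
    by (rule Bochner_Integration.integral_nonneg) auto
  define \<epsilon> where "\<epsilon> = e / (Z + 1)"
  have \<epsilon>: "\<epsilon> > 0" "\<epsilon> * Z \<le> e" using \<open>e > 0\<close> Z by (auto simp: \<epsilon>_def field_simps)
  have "continuous_on {s..t} h" using h st by (auto intro: continuous_on_subset)
  then have "uniformly_continuous_on {s..t} h" by (rule compact_uniformly_continuous) auto
  then obtain d where d: "d > 0" "\<And>x y. x \<in> {s..t} \<Longrightarrow> y \<in> {s..t} \<Longrightarrow> dist y x < d \<Longrightarrow> dist (h y) (h x) < \<epsilon>"
    using \<epsilon>(1) unfolding uniformly_continuous_on_def by metis
  obtain N :: nat where N: "(t - s) / d < real N" using reals_Archimedean2 by blast
  have N0: "N > 0" using N st d by (cases N) (auto simp: field_simps)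
  define \<tau> where "\<tau> i = s + (t - s) * real i / real N" for i
  have \<tau>0: "\<tau> 0 = s" and \<tau>N: "\<tau> N = t" using N0 by (auto simp: \<tau>_def)
  have mono: "\<tau> i \<le> \<tau> j" if "i \<le> j" for i j
    using that st N0 by (auto simp: \<tau>_def intro!: divide_right_mono mult_left_mono)
  have ge: "\<tau> i \<ge> 0" for i using mono[of 0 i] \<tau>0 st by simp
  have step: "\<tau> (Suc i) - \<tau> i < d" for i
  proof -
    have "\<tau> (Suc i) - \<tau> i = (t - s) / real N" by (simp add: \<tau>_def add_divide_distrib distrib_left)
    also have "\<dots> < d" using N d N0 by (simp add: field_simps)
    finally show ?thesis .
  qed
  define X where "X i = incr g 0 (\<tau> i)" for i
  have X: "X j - X i = incr g (\<tau> i) (\<tau> j)" if "i \<le> j" for i j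
    using incr_split[OF g, of 0 "\<tau> i" "\<tau> j"] ge mono[OF that] by (simp add: X_def)
  have D: "norm (\<Sum>l\<in>{0..<N}. (h (\<tau> l) - h (\<tau> 0)) * (X (Suc l) - X l))
       \<le> 2 / (1 - 2 powr (1 - 2*q)) * (a * b) * \<omega> (\<tau> 0) (\<tau> N) powr (2*q)"
    by (rule discrete_young[where \<omega>="\<lambda>i j. \<omega> (\<tau> i) (\<tau> j)"])
       (use q in \<open>auto intro!: nonneg super G H ge mono ab simp: X\<close>)
  have loc: "norm (incr (\<lambda>x. g x * h x) (\<tau> i) (\<tau> (Suc i)) - h (\<tau> i) * incr g (\<tau> i) (\<tau> (Suc i)))
       \<le> \<epsilon> * incr (\<lambda>x. norm (g x)) (\<tau> i) (\<tau> (Suc i))" if "i < N" for i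
  proof -
    have c: "h (\<tau> i) * incr g u v = incr (\<lambda>x. h (\<tau> i) * g x) u v" for u v
      by (simp add: incr_def)
    have c2: "\<epsilon> * incr (\<lambda>x. norm (g x)) u v = incr (\<lambda>x. \<epsilon> * norm (g x)) u v" for u v
      by (simp add: incr_def)
    have ig: "integrable halfline (\<lambda>x. h (\<tau> i) * g x)" using g by simp
    show ?thesis unfolding c c2
    proof (subst incr_minus[OF gh ig, symmetric], rule norm_incr_le)
      show "integrable halfline (\<lambda>x. g x * h x - h (\<tau> i) * g x)" using gh ig by simp
      show "integrable halfline (\<lambda>x. \<epsilon> * norm (g x))" using ng by simp
      fix x assume x: "\<tau> i \<le> x" "x < \<tau> (Suc i)"
      have "s \<le> \<tau> i" "\<tau> (Suc i) \<le> t" using mono[of 0 i] mono[of "Suc i" N] \<tau>0 \<tau>N that by auto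
      then have "dist (h x) (h (\<tau> i)) < \<epsilon>" using x step[of i] by (intro d(2)) (auto simp: dist_real_def)
      then have "norm (g x) * norm (h x - h (\<tau> i)) \<le> norm (g x) * \<epsilon>"
        by (intro mult_left_mono) (auto simp: dist_norm)
      then show "norm (g x * h x - h (\<tau> i) * g x) \<le> \<epsilon> * norm (g x)"
        by (simp add: norm_mult[symmetric] algebra_simps)
    qed
  qed
  have sums: "incr f s t = (\<Sum>i<N. incr f (\<tau> i) (\<tau> (Suc i)))" if "integrable halfline f"
    for f :: "real \<Rightarrow> 'a::{banach,second_countable_topology}"
    using incr_sum[OF that, of \<tau> N] mono \<tau>0 \<tau>N by simp
  \<comment> \<open>The replacement error on each piece, plus a Young sum. Subtracting
    \<open>h (\<tau> 0) = h s\<close> from every value of \<open>h\<close> in the latter accounts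
    for the term \<open>h s * incr g s t\<close>.\<close>
  have "incr (\<lambda>x. g x * h x) s t - h s * incr g s t =
      (\<Sum>i<N. incr (\<lambda>x. g x * h x) (\<tau> i) (\<tau> (Suc i)) - h (\<tau> i) * incr g (\<tau> i) (\<tau> (Suc i)))
      + (\<Sum>l\<in>{0..<N}. (h (\<tau> l) - h (\<tau> 0)) * (X (Suc l) - X l))"
    unfolding sums[OF gh] sums[OF g] atLeast0LessThan
    by (simp add: X sum_distrib_left sum.distrib[symmetric] sum_subtractf[symmetric] \<tau>0 algebra_simps)
  also have "norm \<dots> \<le> (\<Sum>i<N. \<epsilon> * incr (\<lambda>x. norm (g x)) (\<tau> i) (\<tau> (Suc i)))
      + 2 / (1 - 2 powr (1 - 2*q)) * (a * b) * \<omega> s t powr (2*q)"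
    by (intro order.trans[OF norm_triangle_ineq] add_mono sum_norm_le) (use loc D \<tau>0 \<tau>N in auto)
  also have "(\<Sum>i<N. \<epsilon> * incr (\<lambda>x. norm (g x)) (\<tau> i) (\<tau> (Suc i))) = \<epsilon> * Z"
    unfolding Z_def sums[OF ng] by (simp add: sum_distrib_left)
  finally show "norm (incr (\<lambda>x. g x * h x) s t - h s * incr g s t)
      \<le> 2 / (1 - 2 powr (1 - 2*q)) * (a * b) * \<omega> s t powr (2*q) + e"
    using \<epsilon> by linarith
qed

section \<open>Iterated integrals of controlled functions\<close>

text \<open>The head of the list is the outermost, hence largest, variable: the domain is the
  simplex where the coordinates decrease along the list, all of them below \<open>t\<close>.
  \<open>ordered_along\<close> follows the same convention.\<close>

primrec iter :: "(nat \<Rightarrow> real \<Rightarrow> complex) \<Rightarrow> nat list \<Rightarrow> real \<Rightarrow> complex" where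
  "iter g [] t = 1"
| "iter g (i # L) t = incr (\<lambda>x. g i x * iter g L x) 0 t"

text \<open>A qualitative statement from absolute integrability alone. The bound depends on L1
  norms; it only makes the iterated integrals well defined, and the quantitative estimates come from
  the control.\<close>

lemma iter_continuous_bounded:
  assumes "\<And>i. i \<in> set L \<Longrightarrow> integrable halfline (g i)"
  shows "continuous_on UNIV (iter g L) \<and> (\<exists>B. \<forall>x. norm (iter g L x) \<le> B)"
  using assms
proof (induction L)
  case Nil
  then show ?case by (auto intro!: exI[of _ 1] continuous_on_const)
next
  case (Cons i L)
  then obtain B where c: "continuous_on UNIV (iter g L)" and B: "\<And>x. norm (iter g L x) \<le> B" by auto
  have gi: "integrable halfline (\<lambda>x. g i x * iter g L x)"
    using Cons.prems c B by (intro integrable_halfline_mult) (auto intro: continuous_on_subset)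
  have "norm (incr (\<lambda>x. g i x * iter g L x) 0 t) \<le> (\<integral>x. norm (g i x * iter g L x) \<partial>halfline)" for t
    unfolding incr_def set_lebesgue_integral_def
  proof (rule order.trans[OF integral_norm_bound integral_mono])
    show "norm (indicator {0..<t} x *\<^sub>R (g i x * iter g L x)) \<le> norm (g i x * iter g L x)" for x
      by (auto simp: indicator_def)
  qed (intro integrable_norm integrable_halfline_indicator gi; simp)+
  then show ?case using continuous_incr[OF gi] by auto
qed

lemma integrable_iter:
  assumes "\<And>i. i \<in> set L \<Longrightarrow> integrable halfline (g i)" "integrable halfline h"
  shows "integrable halfline (\<lambda>x. h x * iter g L x)"
proof -
  obtain B where "continuous_on UNIV (iter g L)" "\<And>x. norm (iter g L x) \<le> B"
    using iter_continuous_bounded[of L g] assms by auto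
  then show ?thesis
    using assms(2) by (intro integrable_halfline_mult) (auto intro: continuous_on_subset)
qed

text \<open>A control bounds all increments over an interval at once. The strict inequality
  \<open>q > 1/2\<close>, i.e.\ variation exponent below 2, is what makes Young's estimate available.\<close>

locale control =
  fixes \<omega> :: "real \<Rightarrow> real \<Rightarrow> real" and q W :: real
  assumes nonneg: "0 \<le> s \<Longrightarrow> s \<le> t \<Longrightarrow> 0 \<le> \<omega> s t"
    and super: "0 \<le> s \<Longrightarrow> s \<le> u \<Longrightarrow> u \<le> t \<Longrightarrow> \<omega> s u + \<omega> u t \<le> \<omega> s t"
    and bound: "0 \<le> s \<Longrightarrow> s \<le> t \<Longrightarrow> \<omega> s t \<le> W"
    and q: "1/2 < q"
begin

text \<open>Size and increments share one constant so that constants simply multiply when integrals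
  are iterated.\<close>

definition controlled :: "real \<Rightarrow> (real \<Rightarrow> complex) \<Rightarrow> bool" where
  "controlled b h \<longleftrightarrow> continuous_on {0..} h \<and> (\<forall>s\<ge>0. norm (h s) \<le> b) \<and>
     (\<forall>s t. 0 \<le> s \<longrightarrow> s \<le> t \<longrightarrow> norm (h t - h s) \<le> b * \<omega> s t powr q)"

definition driven :: "real \<Rightarrow> (real \<Rightarrow> complex) \<Rightarrow> bool" where
  "driven a g \<longleftrightarrow> integrable halfline g \<and>
     (\<forall>s t. 0 \<le> s \<longrightarrow> s \<le> t \<longrightarrow> norm (incr g s t) \<le> a * \<omega> s t powr q)"

definition K :: real where
  "K = (1 + 2 / (1 - 2 powr (1 - 2*q)) * W powr q) * (1 + W powr q)"

lemma young_constant_nonneg: "0 \<le> 2 / (1 - (2::real) powr (1 - 2*q))"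
proof -
  have "(2::real) powr (1 - 2*q) < 2 powr 0" using q by (intro powr_less_mono) auto
  then show ?thesis by simp
qed

lemma K_ge_1: "K \<ge> 1"
proof -
  have "1 * 1 \<le> K" unfolding K_def
    using young_constant_nonneg by (intro mult_mono) auto
  then show ?thesis by simp
qed

lemma powr_le_bound: "0 \<le> s \<Longrightarrow> s \<le> t \<Longrightarrow> \<omega> s t powr q \<le> W powr q"
  using nonneg bound q by (intro powr_mono2) auto

text \<open>Freezing \<open>h\<close> at the left endpoint leaves a term of order
  \<open>\<omega> s t powr q\<close>. The Young remainder has order
  \<open>\<omega> s t powr (2*q)\<close>, and one of its two factors is traded for
  \<open>W powr q\<close>. Hence the class is closed under integration and induction over chains is
  possible.\<close>

lemma controlled_integral:
  assumes g: "driven a g" and h: "controlled b h" and ab: "0 \<le> a" "0 \<le> b"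
  shows "controlled (K * a * b) (\<lambda>t. incr (\<lambda>x. g x * h x) 0 t)"
proof -
  define c where "c = 2 / (1 - (2::real) powr (1 - 2*q))"
  have c: "c \<ge> 0" using young_constant_nonneg by (simp add: c_def)
  have gi: "integrable halfline g" and hc: "continuous_on {0..} h"
    and hb: "\<And>x. x \<ge> 0 \<Longrightarrow> norm (h x) \<le> b"
    and G: "\<And>s t. 0 \<le> s \<Longrightarrow> s \<le> t \<Longrightarrow> norm (incr g s t) \<le> a * \<omega> s t powr q"
    and H: "\<And>s t. 0 \<le> s \<Longrightarrow> s \<le> t \<Longrightarrow> norm (h t - h s) \<le> b * \<omega> s t powr q"
    using g h by (auto simp: driven_def controlled_def)
  have ghi: "integrable halfline (\<lambda>x. g x * h x)" using integrable_halfline_mult[OF gi hc hb] .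
  have main: "norm (incr (\<lambda>x. g x * h x) s t) \<le> (1 + c * W powr q) * (a * b) * \<omega> s t powr q"
    if st: "0 \<le> s" "s \<le> t" for s t
  proof -
    have "norm (incr (\<lambda>x. g x * h x) s t) \<le> norm (h s * incr g s t)
        + norm (incr (\<lambda>x. g x * h x) s t - h s * incr g s t)"
      using norm_triangle_sub by blast
    also have "norm (h s * incr g s t) \<le> b * (a * \<omega> s t powr q)"
      unfolding norm_mult using hb[of s] G[OF st] st ab by (intro mult_mono) auto
    also have "norm (incr (\<lambda>x. g x * h x) s t - h s * incr g s t) \<le> c * (a * b) * \<omega> s t powr (2*q)"
      unfolding c_def by (rule young_step[OF nonneg super gi hc hb G H ab q st])
    also have "\<omega> s t powr (2*q) = \<omega> s t powr q * \<omega> s t powr q"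
      by (simp add: powr_add[symmetric])
    also have "c * (a * b) * (\<omega> s t powr q * \<omega> s t powr q) \<le> c * (a * b) * (W powr q * \<omega> s t powr q)"
      using powr_le_bound[OF st] c ab by (intro mult_left_mono mult_right_mono) auto
    finally show ?thesis by (simp add: algebra_simps)
  qed
  \<comment> \<open>Serves both requirements: \<open>z' = 1\<close> gives the bound on the size,
    \<open>z = z'\<close> the one on increments.\<close>
  have le: "(1 + c * W powr q) * (a * b) * z \<le> K * a * b * z'"
    if "z \<le> (1 + W powr q) * z'" for z z'
  proof -
    have "(1 + c * W powr q) * (a * b) * z \<le> (1 + c * W powr q) * (a * b) * ((1 + W powr q) * z')"
      using that c ab by (intro mult_left_mono) auto
    then show ?thesis by (simp add: K_def c_def mult_ac)
  qed
  show ?thesis unfolding controlled_def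
  proof (intro conjI allI impI)
    show "continuous_on {0..} (\<lambda>t. incr (\<lambda>x. g x * h x) 0 t)"
      using continuous_incr[OF ghi] by (rule continuous_on_subset) auto
  next
    fix s :: real assume s: "0 \<le> s"
    show "norm (incr (\<lambda>x. g x * h x) 0 s) \<le> K * a * b"
      using order.trans[OF main[of 0 s] le[of _ 1]] powr_le_bound[of 0 s] s by auto
  next
    fix s t :: real assume st: "0 \<le> s" "s \<le> t"
    have "incr (\<lambda>x. g x * h x) 0 t - incr (\<lambda>x. g x * h x) 0 s = incr (\<lambda>x. g x * h x) s t"
      using incr_split[OF ghi, of 0 s t] st by simp
    moreover have "\<omega> s t powr q \<le> (1 + W powr q) * \<omega> s t powr q"
      using mult_right_mono[of 1 "1 + W powr q" "\<omega> s t powr q"] by simp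
    ultimately show "norm (incr (\<lambda>x. g x * h x) 0 t - incr (\<lambda>x. g x * h x) 0 s) \<le> K * a * b * \<omega> s t powr q"
      using order.trans[OF main[OF st] le] by simp
  qed
qed

lemma controlled_iter:
  assumes "\<And>i. i \<in> set L \<Longrightarrow> driven a (g i)" "0 \<le> a"
  shows "controlled ((K * a) ^ length L) (iter g L)"
  using assms(1)
proof (induction L)
  case Nil
  then show ?case by (auto simp: controlled_def)
next
  case (Cons i L)
  have "controlled (K * a * (K * a) ^ length L) (\<lambda>t. incr (\<lambda>x. g i x * iter g L x) 0 t)"
    using Cons assms(2) K_ge_1 by (intro controlled_integral) auto
  then show ?case by (simp add: fun_eq_iff cong: arg_cong2[where f=controlled] flip: iter.simps(2))
qed

lemma controlled_add:
  assumes "controlled a g" "controlled b h"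
  shows "controlled (a + b) (\<lambda>x. g x + h x)"
  unfolding controlled_def
proof (intro conjI allI impI)
  show "continuous_on {0..} (\<lambda>x. g x + h x)"
    using assms by (auto simp: controlled_def intro!: continuous_intros)
next
  fix s :: real assume "0 \<le> s"
  then show "norm (g s + h s) \<le> a + b"
    using assms by (auto simp: controlled_def intro!: order.trans[OF norm_triangle_ineq] add_mono)
next
  fix s t :: real assume "0 \<le> s" "s \<le> t"
  then have "norm ((g t - g s) + (h t - h s)) \<le> a * \<omega> s t powr q + b * \<omega> s t powr q"
    using assms by (intro order.trans[OF norm_triangle_ineq] add_mono) (auto simp: controlled_def)
  then show "norm (g t + h t - (g s + h s)) \<le> (a + b) * \<omega> s t powr q"
    by (simp add: algebra_simps)
qed

text \<open>Telescoping: the integrands are exchanged one at a time, through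
  \<open>g i * (I - I') + (g i - g' i) * I'\<close> with \<open>I\<close>, \<open>I'\<close> the
  inner integrals. Each exchange costs one factor \<open>\<eta>\<close>, which explains the factor
  \<open>length L\<close>.\<close>

lemma controlled_iter_diff:
  assumes "\<And>i. i \<in> set L \<Longrightarrow> driven a (g i)" "\<And>i. i \<in> set L \<Longrightarrow> driven a (g' i)"
    "\<And>i. i \<in> set L \<Longrightarrow> driven (\<eta> * a) (\<lambda>x. g i x - g' i x)" "0 \<le> a" "0 \<le> \<eta>"
  shows "controlled (\<eta> * length L * (K * a) ^ length L) (\<lambda>t. iter g L t - iter g' L t)"
  using assms(1-3)
proof (induction L)
  case Nil
  then show ?case by (auto simp: controlled_def)
next
  case (Cons i L)
  have gL: "\<And>j. j \<in> set L \<Longrightarrow> integrable halfline (g j)" "\<And>j. j \<in> set L \<Longrightarrow> integrable halfline (g' j)"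
    and gi: "integrable halfline (g i)" "integrable halfline (g' i)"
    using Cons.prems by (auto simp: driven_def)
  have c1: "controlled (K * a * (\<eta> * length L * (K * a) ^ length L))
      (\<lambda>t. incr (\<lambda>x. g i x * (iter g L x - iter g' L x)) 0 t)"
    using Cons assms(4,5) K_ge_1 by (intro controlled_integral) auto
  have c2: "controlled (K * (\<eta> * a) * (K * a) ^ length L)
      (\<lambda>t. incr (\<lambda>x. (g i x - g' i x) * iter g' L x) 0 t)"
    using Cons assms(4,5) K_ge_1 by (intro controlled_integral controlled_iter) auto
  have "incr (\<lambda>x. g i x * (iter g L x - iter g' L x)) 0 t + incr (\<lambda>x. (g i x - g' i x) * iter g' L x) 0 t
      = iter g (i # L) t - iter g' (i # L) t" for t
  proof -
    have "incr (\<lambda>x. g i x * iter g L x - g' i x * iter g' L x) 0 t = iter g (i # L) t - iter g' (i # L) t"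
      by (simp add: incr_minus integrable_iter gL gi)
    moreover have "incr (\<lambda>x. g i x * iter g L x - g' i x * iter g' L x) 0 t =
       incr (\<lambda>x. (g i x * iter g L x - g i x * iter g' L x) + (g i x * iter g' L x - g' i x * iter g' L x)) 0 t"
      by simp
    ultimately show ?thesis
      by (subst (asm) incr_add) (auto intro!: integrable_iter gL gi Bochner_Integration.integrable_diff simp: algebra_simps)
  qed
  moreover have "K * a * (\<eta> * length L * (K * a) ^ length L) + K * (\<eta> * a) * (K * a) ^ length L
     = \<eta> * length (i # L) * (K * a) ^ length (i # L)"
    by (simp add: algebra_simps)
  ultimately show ?case using controlled_add[OF c1 c2] by (simp only:)
qed

end

section \<open>Decomposition into chains\<close>

interpretation halfline: product_sigma_finite "\<lambda>_::nat. halfline"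
  by (intro product_sigma_finite.intro sigma_finite_lebesgue_on) simp

lemma component_measurable_halfline:
  "i \<in> J \<Longrightarrow> (\<lambda>x. x i) \<in> borel_measurable (PiM J (\<lambda>_::nat. halfline))"
  by (rule measurable_compose[OF measurable_component_singleton[of i J "\<lambda>_. halfline"]
        measurable_halfline[OF measurable_ident_sets[OF refl]]])

definition ordered_along :: "nat list \<Rightarrow> (nat \<Rightarrow> real) \<Rightarrow> bool" where
  "ordered_along L x \<longleftrightarrow> sorted_wrt (\<lambda>i j. x j < x i) L"

lemma ordered_along_Cons [simp]:
  "ordered_along (i # L) x \<longleftrightarrow> (\<forall>j\<in>set L. x j < x i) \<and> ordered_along L x"
  by (simp add: ordered_along_def)

lemma pred_component_less:
  assumes "i \<in> J" "j \<in> J"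
  shows "Measurable.pred (PiM J (\<lambda>_::nat. halfline)) (\<lambda>x. x i < x j)"
    and "Measurable.pred (PiM J (\<lambda>_::nat. halfline)) (\<lambda>x. x i < t)"
  by (intro borel_measurable_pred_less component_measurable_halfline assms measurable_const UNIV_I; simp)+

lemma pred_component_eq:
  assumes "i \<in> J" "j \<in> J"
  shows "Measurable.pred (PiM J (\<lambda>_::nat. halfline)) (\<lambda>x. x i = x j)"
  unfolding pred_def
  by (rule borel_measurable_eq) (intro component_measurable_halfline assms)+

lemma pred_ordered_along:
  assumes "set L \<subseteq> J"
  shows "Measurable.pred (PiM J (\<lambda>_::nat. halfline)) (\<lambda>x. ordered_along L x \<and> (\<forall>j\<in>set L. x j < t))"
proof -
  have "Measurable.pred (PiM J (\<lambda>_::nat. halfline)) (\<lambda>x. ordered_along L x)"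
    using assms
  proof (induction L)
    case Nil
    then show ?case by (simp add: ordered_along_def)
  next
    case (Cons i L)
    then show ?case unfolding ordered_along_Cons
      by (intro pred_intros_logic(3) pred_intros_finite(3) pred_component_less) auto
  qed
  then show ?thesis
    using assms by (intro pred_intros_logic(3) pred_intros_finite(3) pred_component_less(2)) auto
qed

lemma integrable_prod_cut:
  fixes g :: "nat \<Rightarrow> real \<Rightarrow> complex"
  assumes "finite J" "\<And>j. j \<in> J \<Longrightarrow> integrable halfline (g j)"
    and P: "Measurable.pred (PiM J (\<lambda>_. halfline)) P"
  shows "integrable (PiM J (\<lambda>_. halfline)) (\<lambda>x. (\<Prod>j\<in>J. g j (x j)) * of_bool (P x))"
proof -
  have i: "integrable (PiM J (\<lambda>_. halfline)) (\<lambda>x. \<Prod>j\<in>J. g j (x j))"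
    using assms by (intro halfline.product_integrable_prod) auto
  show ?thesis
  proof (rule Bochner_Integration.integrable_bound[OF i])
    have "(\<lambda>x. of_bool (P x) :: complex) \<in> borel_measurable (PiM J (\<lambda>_. halfline))"
      using P by (rule measurable_compose) simp
    then show "(\<lambda>x. (\<Prod>j\<in>J. g j (x j)) * of_bool (P x)) \<in> borel_measurable (PiM J (\<lambda>_. halfline))"
      by (intro borel_measurable_times borel_measurable_integrable[OF i])
  qed auto
qed

text \<open>Fubini with the head coordinate integrated last. Once it is fixed, the inner integral is
  of the same kind with ceiling \<open>x i\<close> instead of \<open>t\<close>, so the induction
  must leave \<open>t\<close> arbitrary.\<close>

lemma integral_ordered_along:
  assumes "distinct L" "\<And>j. j \<in> set L \<Longrightarrow> integrable halfline (g j)"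
  shows "(LINT x|PiM (set L) (\<lambda>_. halfline). (\<Prod>j\<in>set L. g j (x j)) *
            of_bool (ordered_along L x \<and> (\<forall>j\<in>set L. x j < t))) = iter g L t"
  using assms
proof (induction L arbitrary: t)
  case Nil
  interpret finite_measure "PiM {} (\<lambda>_::nat. halfline)"
    by rule (simp add: space_PiM)
  show ?case by (simp add: ordered_along_def space_PiM measure_def)
next
  case (Cons i L)
  let ?J = "set L" and ?M = "\<lambda>_::nat. halfline"
  define F where "F x = (\<Prod>j\<in>insert i ?J. g j (x j)) *
     of_bool (ordered_along (i # L) x \<and> (\<forall>j\<in>insert i ?J. x j < t))" for x
  have iJ: "i \<notin> ?J" using Cons.prems by simp
  have F: "integrable (PiM ({i} \<union> ?J) ?M) F"
    unfolding F_def using Cons.prems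
    by (simp only: Un_insert_left Un_empty_left, intro integrable_prod_cut pred_ordered_along[of "i # L", unfolded list.set(2)]) auto
  \<comment> \<open>The constraints \<open>y j < x i\<close> come from the ordering; together with
    \<open>x i < t\<close> they imply the ceilings \<open>y j < t\<close>, which therefore
    disappear.\<close>
  have eq: "F (merge {i} ?J (x, y)) = g i (x i) * of_bool (x i < t) *
       ((\<Prod>j\<in>?J. g j (y j)) * of_bool (ordered_along L y \<and> (\<forall>j\<in>?J. y j < x i)))" for x y
  proof -
    have m: "merge {i} ?J (x, y) i = x i" "\<And>j. j \<in> ?J \<Longrightarrow> merge {i} ?J (x, y) j = y j"
      using iJ by (auto simp: merge_def)
    have "ordered_along L (merge {i} ?J (x, y)) \<longleftrightarrow> ordered_along L y"
      by (simp add: ordered_along_def sorted_wrt_iff_nth_less m)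
    moreover have "(\<Prod>j\<in>?J. g j (merge {i} ?J (x, y) j)) = (\<Prod>j\<in>?J. g j (y j))"
      by (intro prod.cong) (auto simp: m)
    ultimately show ?thesis
      unfolding F_def using iJ by (auto simp: m of_bool_def)
  qed
  obtain B where B: "continuous_on UNIV (iter g L)" "\<And>x. norm (iter g L x) \<le> B"
    using iter_continuous_bounded[of L g] Cons.prems by auto
  have "(LINT x|PiM (insert i ?J) ?M. F x) = (LINT x|PiM {i} ?M. LINT y|PiM ?J ?M. F (merge {i} ?J (x, y)))"
    using halfline.product_integral_fold[of "{i}" ?J F] F iJ by simp
  also have "\<dots> = (LINT x|PiM {i} ?M. g i (x i) * of_bool (x i < t) * iter g L (x i))"
    unfolding eq using Cons by simp
  also have "\<dots> = (LINT z|halfline. g i z * of_bool (z < t) * iter g L z)"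
  proof (rule halfline.product_integral_singleton[of "\<lambda>z. g i z * of_bool (z < t) * iter g L z"])
    have "iter g L \<in> borel_measurable halfline"
      by (intro continuous_on_measurable_halfline continuous_on_subset[OF B(1)]) auto
    moreover have "g i \<in> borel_measurable halfline" using Cons.prems by auto
    moreover have "(\<lambda>z::real. of_bool (z < t) :: complex) \<in> borel_measurable halfline"
      by (intro measurable_halfline) measurable
    ultimately show "(\<lambda>z. g i z * of_bool (z < t) * iter g L z) \<in> borel_measurable halfline"
      by (intro borel_measurable_times)
  qed
  also have "\<dots> = iter g (i # L) t"
    unfolding iter.simps incr_def set_lebesgue_integral_def
    by (intro Bochner_Integration.integral_cong) (auto simp: space_restrict_space indicator_def)
  finally show ?case by (simp add: F_def)
qed

text \<open>By Tonelli: with all other coordinates fixed, the diagonal meets the line of coordinate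
  \<open>i\<close> in at most one point.\<close>

lemma AE_PiM_halfline_neq:
  fixes i :: nat
  assumes J: "finite J" "i \<in> J" "j \<in> J" "i \<noteq> j"
  shows "AE x in PiM J (\<lambda>_. halfline). x i \<noteq> x j"
proof -
  let ?M = "\<lambda>_::nat. halfline" and ?J = "J - {i}"
  have eqJ: "insert i ?J = J" using J by auto
  have m: "(\<lambda>x. indicator {x. x i = x j} x :: ennreal) \<in> borel_measurable (PiM J ?M)"
  proof -
    have "Measurable.pred (PiM J ?M) (\<lambda>x. x i = x j)"
      by (intro pred_component_eq J)
    then have *: "(\<lambda>x. of_bool (x i = x j) :: ennreal) \<in> borel_measurable (PiM J ?M)"
      by (rule measurable_compose) simp
    have eq: "(indicator {x. x i = x j} :: (nat \<Rightarrow> real) \<Rightarrow> ennreal) = (\<lambda>x. of_bool (x i = x j))"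
      by (simp add: fun_eq_iff indicator_def)
    show ?thesis unfolding eq by (rule *)
  qed
  have "(\<integral>\<^sup>+x. indicator {x. x i = x j} x \<partial>PiM (insert i ?J) ?M) =
      (\<integral>\<^sup>+x. \<integral>\<^sup>+y. indicator {x. x i = x j} (x(i := y)) \<partial>halfline \<partial>PiM ?J ?M)"
    by (rule halfline.product_nn_integral_insert) (use J m in \<open>simp_all only: eqJ\<close>, auto)
  also have "\<dots> = (\<integral>\<^sup>+x. 0 \<partial>PiM ?J ?M)"
  proof (intro nn_integral_cong)
    fix x
    have "(\<integral>\<^sup>+y. indicator {x. x i = x j} (x(i := y)) \<partial>halfline) = (\<integral>\<^sup>+y. 0 \<partial>halfline)"
      by (rule nn_integral_cong_AE) (use AE_halfline_neq[of "x j"] J(4) in \<open>auto simp: indicator_def elim!: eventually_mono\<close>)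
    then show "(\<integral>\<^sup>+y. indicator {x. x i = x j} (x(i := y)) \<partial>halfline) = 0" by simp
  qed
  finally have "(\<integral>\<^sup>+x. indicator {x. x i = x j} x \<partial>PiM J ?M) = 0"
    by (simp only: eqJ nn_integral_const) simp
  then have "AE x in PiM J ?M. indicator {x. x i = x j} x = (0::ennreal)"
    using nn_integral_0_iff_AE[OF m] by simp
  then show ?thesis by (auto simp: indicator_def elim!: eventually_mono)
qed

lemma AE_PiM_halfline_inj:
  assumes "finite J"
  shows "AE x in PiM J (\<lambda>_::nat. halfline). inj_on x J"
proof -
  have "AE x in PiM J (\<lambda>_::nat. halfline). \<forall>(i, j)\<in>{(i, j)\<in>J \<times> J. i \<noteq> j}. x i \<noteq> x j"
  proof (rule AE_finite_allI)
    show "finite {(i, j)\<in>J \<times> J. i \<noteq> j}"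
      by (rule finite_subset[of _ "J \<times> J"]) (use assms in auto)
  qed (use AE_PiM_halfline_neq[OF assms] in auto)
  then show ?thesis by (auto simp: inj_on_def elim!: eventually_mono)
qed

definition orderings :: "nat set \<Rightarrow> nat list set" where
  "orderings J = {L. set L = J \<and> distinct L}"

lemma finite_orderings: "finite J \<Longrightarrow> finite (orderings J)"
  unfolding orderings_def by (rule finite_subset[OF _ finite_subset_distinct[of J]]) auto

lemma ex1_ordered_along:
  assumes "finite J" "inj_on x J"
  shows "\<exists>!L. L \<in> orderings J \<and> ordered_along L x"
proof -
  \<comment> \<open>The sign change turns the decreasing order along \<open>L\<close> into the
    increasing order of \<open>sorted_list_of_set\<close>.\<close>
  let ?k = "\<lambda>i. - x i"
  have inj: "inj_on ?k J" using assms by (auto simp: inj_on_def)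
  have ord: "ordered_along L x \<longleftrightarrow> sorted_wrt (<) (map ?k L)" for L
    by (simp add: ordered_along_def sorted_wrt_map)
  define L where "L = map (inv_into J ?k) (sorted_list_of_set (?k ` J))"
  have k: "map ?k L = sorted_list_of_set (?k ` J)"
    unfolding L_def map_map using assms(1) by (intro map_idI) (auto simp: f_inv_into_f[of _ ?k])
  have "set L = inv_into J ?k ` ?k ` J" using assms(1) by (simp add: L_def)
  also have "\<dots> = J" by (rule inv_into_image_cancel[OF inj]) simp
  finally have "set L = J" .
  moreover have "distinct L" using k by (metis distinct_map distinct_sorted_list_of_set)
  moreover have "ordered_along L x" unfolding ord k by simp
  ultimately have ex: "L \<in> orderings J \<and> ordered_along L x" by (simp add: orderings_def)
  moreover have "L' = L" if "L' \<in> orderings J \<and> ordered_along L' x" for L'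
  proof -
    have "map ?k L' = map ?k L"
      using that ex by (intro strict_sorted_equal[symmetric]) (auto simp: ord orderings_def)
    then show ?thesis
      by (rule map_inj_on) (use that ex inj in \<open>simp add: orderings_def\<close>)
  qed
  ultimately show ?thesis by blast
qed

text \<open>For a distinct list this says that \<open>i\<close> stands before \<open>i'\<close>. If
  \<open>A\<close> contains a pair \<open>(i, i)\<close> or a cycle, no distinct list qualifies; the
  sum over chains is then 0, as is the integrand of the operator.\<close>

definition extends :: "(nat \<times> nat) set \<Rightarrow> nat list \<Rightarrow> bool" where
  "extends A L \<longleftrightarrow> (\<forall>(i, i')\<in>A. \<exists>u v. u < v \<and> v < length L \<and> L ! u = i \<and> L ! v = i')"

lemma extends_iff:
  assumes "ordered_along L x" "A \<subseteq> set L \<times> set L"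
  shows "extends A L \<longleftrightarrow> (\<forall>(i, i')\<in>A. x i' < x i)"
proof -
  have o: "x (L ! v) < x (L ! u)" if "u < v" "v < length L" for u v
    using assms(1) that by (simp add: ordered_along_def sorted_wrt_iff_nth_less)
  have "(\<exists>u v. u < v \<and> v < length L \<and> L ! u = i \<and> L ! v = i') \<longleftrightarrow> x i' < x i"
    if "(i, i') \<in> A" for i i'
  proof
    assume less: "x i' < x i"
    have "i \<in> set L" "i' \<in> set L" using that assms(2) by auto
    then obtain u v where uv: "u < length L" "v < length L" "L ! u = i" "L ! v = i'"
      unfolding in_set_conv_nth by blast
    have "\<not> v < u" using o[of v u] uv less by auto
    moreover have "u \<noteq> v" using uv less by auto
    ultimately have "u < v" by linarith
    then show "\<exists>u v. u < v \<and> v < length L \<and> L ! u = i \<and> L ! v = i'" using uv by blast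
  qed (auto intro: o)
  then show ?thesis unfolding extends_def by (intro ball_cong refl) (simp add: case_prod_beta)
qed

text \<open>Off the null set where two coordinates coincide, exactly one linear ordering is realised,
  so a system of order constraints is the disjoint union of the chains extending it.\<close>

lemma multilinear_op_eq_sum_iter:
  assumes A: "A \<subseteq> {1..n} \<times> {1..n}"
    and int: "\<And>i. i \<in> {1..n} \<Longrightarrow> integrable halfline (\<lambda>x. f i x * k i l x * indicator {..<D i} x)"
    and t: "\<And>i. i \<in> {1..n} \<Longrightarrow> D i \<le> t"
  shows "multilinear_op n A k D f l = (\<Sum>L\<in>orderings {1..n}. of_bool (extends A L) *
           iter (\<lambda>i x. f i x * k i l x * indicator {..<D i} x) L t)"
proof -
  let ?J = "{1..n}" and ?M = "\<lambda>_::nat. halfline"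
  \<comment> \<open>The individual cut-offs are moved into the functions, so that all chains can
    share the single ceiling \<open>t\<close>.\<close>
  define g where "g i x = f i x * k i l x * indicator {..<D i} x" for i x
  have fA: "finite A" using A by (rule finite_subset) auto
  have P1: "(\<Prod>(i, i')\<in>A. indicator {0<..} (x i - x i')) = (of_bool (\<forall>(i, i')\<in>A. x i' < x i) :: complex)" for x :: "nat \<Rightarrow> real"
  proof (cases "\<forall>(i, i')\<in>A. x i' < x i")
    case True
    then have "(\<Prod>(i, i')\<in>A. indicator {0<..} (x i - x i')) = (\<Prod>(i, i')\<in>A. 1 :: complex)"
      by (intro prod.cong) auto
    then show ?thesis using True by simp
  next
    case False
    then obtain i i' where "(i, i') \<in> A" "\<not> x i' < x i" by auto
    then have "(\<Prod>(i, i')\<in>A. indicator {0<..} (x i - x i')) = (0 :: complex)"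
      using fA by (intro prod_zero bexI[of _ "(i, i')"]) auto
    then show ?thesis using False by (simp only: of_bool_eq)
  qed
  have intL: "integrable (PiM ?J ?M) (\<lambda>x. (\<Prod>j\<in>?J. g j (x j)) * of_bool (ordered_along L x \<and> (\<forall>j\<in>set L. x j < t)))"
    if "L \<in> orderings ?J" for L
    using that int unfolding g_def orderings_def
    by (intro integrable_prod_cut pred_ordered_along) auto
  have "multilinear_op n A k D f l =
     (LINT x|PiM ?J ?M. ((\<Prod>j\<in>?J. g j (x j)) * of_bool (\<forall>(i, i')\<in>A. x i' < x i)))"
    unfolding multilinear_op_def P1 unfolding g_def indicator_def
    by (rule Bochner_Integration.integral_cong) (simp_all only: greaterThan_iff lessThan_iff diff_gt_0_iff_gt)
  also have "\<dots> = (LINT x|PiM ?J ?M. (\<Sum>L\<in>orderings ?J. of_bool (extends A L) *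
      ((\<Prod>j\<in>?J. g j (x j)) * of_bool (ordered_along L x \<and> (\<forall>j\<in>set L. x j < t)))))"
  proof (rule integral_cong_AE)
    have "AE x in PiM ?J ?M. inj_on x ?J" by (rule AE_PiM_halfline_inj) simp
    then show "AE x in PiM ?J ?M. (\<Prod>j\<in>?J. g j (x j)) * of_bool (\<forall>(i, i')\<in>A. x i' < x i) =
      (\<Sum>L\<in>orderings ?J. of_bool (extends A L) *
      ((\<Prod>j\<in>?J. g j (x j)) * of_bool (ordered_along L x \<and> (\<forall>j\<in>set L. x j < t))))"
    proof eventually_elim
      case (elim x)
      obtain L0 where L0: "L0 \<in> orderings ?J" "ordered_along L0 x"
        and uniq: "\<And>L. L \<in> orderings ?J \<Longrightarrow> ordered_along L x \<Longrightarrow> L = L0"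
        using ex1_ordered_along[OF _ elim] by auto
      have "(\<Sum>L\<in>orderings ?J. of_bool (extends A L) *
         ((\<Prod>j\<in>?J. g j (x j)) * of_bool (ordered_along L x \<and> (\<forall>j\<in>set L. x j < t))))
        = (\<Sum>L\<in>{L0}. of_bool (extends A L) *
         ((\<Prod>j\<in>?J. g j (x j)) * of_bool (ordered_along L x \<and> (\<forall>j\<in>set L. x j < t))))"
      proof (rule sum.mono_neutral_right)
        show "finite (orderings ?J)" by (rule finite_orderings) simp
        show "\<forall>L\<in>orderings ?J - {L0}. of_bool (extends A L) *
         ((\<Prod>j\<in>?J. g j (x j)) * of_bool (ordered_along L x \<and> (\<forall>j\<in>set L. x j < t))) = 0"
        proof
          fix L assume "L \<in> orderings ?J - {L0}"
          then have "\<not> ordered_along L x" using uniq by blast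
          then show "of_bool (extends A L) *
            ((\<Prod>j\<in>?J. g j (x j)) * of_bool (ordered_along L x \<and> (\<forall>j\<in>set L. x j < t))) = 0"
            by simp
        qed
      qed (use L0 in simp)
      also have "\<dots> = (\<Prod>j\<in>?J. g j (x j)) * of_bool (\<forall>(i, i')\<in>A. x i' < x i)"
      proof (cases "\<forall>j\<in>?J. x j < t")
        case True
        moreover have "set L0 = ?J" using L0(1) unfolding orderings_def by blast
        ultimately show ?thesis using extends_iff[OF L0(2), of A] L0(2) A by simp
      next
        \<comment> \<open>Some coordinate lies beyond the ceiling, hence beyond its own cut-off, so
          its factor \<open>g j (x j)\<close> kills both sides.\<close>
        case False
        then obtain j where "j \<in> ?J" "\<not> x j < t" by auto
        then have "g j (x j) = 0" using t[of j] by (simp add: g_def indicator_def)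
        then have "(\<Prod>j\<in>?J. g j (x j)) = 0" using \<open>j \<in> ?J\<close> by (intro prod_zero) auto
        then show ?thesis by simp
      qed
      finally show ?case by simp
    qed
    show "(\<lambda>x. \<Sum>L\<in>orderings ?J. of_bool (extends A L) *
      ((\<Prod>j\<in>?J. g j (x j)) * of_bool (ordered_along L x \<and> (\<forall>j\<in>set L. x j < t)))) \<in> borel_measurable (PiM ?J ?M)"
      by (intro borel_measurable_integrable Bochner_Integration.integrable_sum integrable_mult_right intL)
    have "Measurable.pred (PiM ?J ?M) (\<lambda>x. \<forall>a\<in>A. x (snd a) < x (fst a))"
      using A by (intro pred_intros_finite(3) fA pred_component_less(1)) auto
    then have "integrable (PiM ?J ?M) (\<lambda>x. (\<Prod>j\<in>?J. g j (x j)) * of_bool (\<forall>a\<in>A. x (snd a) < x (fst a)))"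
      using int by (intro integrable_prod_cut) (auto simp: g_def)
    then show "(\<lambda>x. (\<Prod>j\<in>?J. g j (x j)) * of_bool (\<forall>(i, i')\<in>A. x i' < x i)) \<in> borel_measurable (PiM ?J ?M)"
      unfolding case_prod_beta by (rule borel_measurable_integrable)
  qed
  also have "\<dots> = (\<Sum>L\<in>orderings ?J. of_bool (extends A L) * iter g L t)"
  proof (subst Bochner_Integration.integral_sum)
    show "(\<Sum>L\<in>orderings ?J. LINT x|PiM ?J ?M. of_bool (extends A L) *
        ((\<Prod>j\<in>?J. g j (x j)) * of_bool (ordered_along L x \<and> (\<forall>j\<in>set L. x j < t))))
      = (\<Sum>L\<in>orderings ?J. of_bool (extends A L) * iter g L t)"
    proof (intro sum.cong refl)
      fix L assume "L \<in> orderings ?J"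
      then have L: "set L = ?J" "distinct L" by (auto simp: orderings_def)
      have "(LINT x|PiM ?J ?M. (\<Prod>j\<in>?J. g j (x j)) * of_bool (ordered_along L x \<and> (\<forall>j\<in>set L. x j < t))) = iter g L t"
        unfolding L(1)[symmetric] by (rule integral_ordered_along[OF L(2)]) (use int L(1) in \<open>auto simp: g_def\<close>)
      then show "(LINT x|PiM ?J ?M. of_bool (extends A L) *
        ((\<Prod>j\<in>?J. g j (x j)) * of_bool (ordered_along L x \<and> (\<forall>j\<in>set L. x j < t)))) = of_bool (extends A L) * iter g L t"
        by (simp only: integral_mult_right_zero)
    qed
  qed (intro integrable_mult_right intL)
  finally show ?thesis by (simp add: g_def[abs_def])
qed

section \<open>Measurability of slices\<close>

text \<open>The set \<open>S\<close> is Borel up to part of a Borel null set, and the strip over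
  that null set is null in the plane. Completeness of planar Lebesgue measure does the rest.\<close>

lemma Times_sets_lebesgue:
  fixes S T :: "real set"
  assumes S: "S \<in> sets lebesgue" and T: "T \<in> sets borel"
  shows "S \<times> T \<in> sets lebesgue"
proof -
  obtain B N N' where B: "S = B \<union> N" "N \<subseteq> N'" "N' \<in> null_sets lborel" "B \<in> sets lborel"
    using S by (rule sets_completionE)
  have "B \<times> T \<in> sets (lborel \<Otimes>\<^sub>M lborel)" using B(4) T by (intro pair_measureI) auto
  then have "B \<times> T \<in> sets (lborel :: (real \<times> real) measure)" unfolding lborel_prod .
  then have 1: "B \<times> T \<in> sets lebesgue" by (rule sets_completionI_sets)
  have "N' \<times> UNIV \<in> null_sets (lborel \<Otimes>\<^sub>M lborel)"
    using B(3) lborel.emeasure_pair_measure_Times[of N' lborel UNIV]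
    by (intro null_setsI pair_measureI) (auto simp: null_sets_def)
  then have "N' \<times> UNIV \<in> null_sets (lborel :: (real \<times> real) measure)" unfolding lborel_prod .
  then have "N \<times> T \<in> null_sets (lebesgue :: (real \<times> real) measure)"
    using B(2) by (intro null_sets_completion_subset[OF _ null_sets_completionI, of _ "N' \<times> UNIV"]) auto
  then have "B \<times> T \<union> N \<times> T \<in> sets lebesgue" using 1 by (intro sets.Un) auto
  then show ?thesis unfolding B(1) by (simp add: Sigma_Un_distrib1)
qed

text \<open>Measurability for the completed planar measure says nothing about a single slice. The
  kernel agrees with a Borel function off a planar null set; by Fubini almost every slice agrees
  almost everywhere with a Borel slice and is then measurable by completeness on the line. Real and
  imaginary parts are treated separately.\<close>

lemma AE_slice_measurable:
  fixes \<kappa> :: "real \<Rightarrow> real \<Rightarrow> complex"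
  assumes I: "I \<in> sets lebesgue" and T: "T \<in> sets borel"
    and \<kappa>: "(\<lambda>(l, x). \<kappa> l x) \<in> borel_measurable (lebesgue_on (I \<times> T))"
  shows "AE l in lebesgue_on I. \<kappa> l \<in> borel_measurable (lebesgue_on T)"
proof -
  define F where "F z = (if z \<in> I \<times> T then case z of (l, x) \<Rightarrow> \<kappa> l x else 0)" for z
  have F: "F \<in> borel_measurable lebesgue"
    using borel_measurable_if_I[OF \<kappa> Times_sets_lebesgue[OF I T]] by (simp add: F_def[abs_def])
  have slice: "AE l in lborel. (\<lambda>x. R (F (l, x))) \<in> borel_measurable lebesgue"
    if R: "R \<in> borel_measurable borel" for R :: "complex \<Rightarrow> real"
  proof -
    have "(\<lambda>z. R (F z)) \<in> borel_measurable lebesgue" using F R by (rule measurable_compose)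
    then obtain r where r: "r \<in> borel_measurable lborel" "AE z in lborel. R (F z) = r z"
      using completion_ex_borel_measurable_real by blast
    have "AE z in lborel \<Otimes>\<^sub>M lborel. R (F z) = r z" using r(2) unfolding lborel_prod .
    then have "AE l in lborel. AE x in lborel. R (F (l, x)) = r (l, x)" by (rule lborel_pair.AE_pair)
    then show ?thesis
    proof eventually_elim
      case (elim l)
      have "r \<in> borel_measurable (lborel \<Otimes>\<^sub>M lborel)" using r(1) unfolding lborel_prod .
      then have "(\<lambda>x. r (l, x)) \<in> borel_measurable lborel"
        by (rule measurable_compose[OF measurable_Pair1', rotated]) simp
      then have "(\<lambda>x. r (l, x)) \<in> borel_measurable lebesgue" by (rule measurable_completion)
      moreover have "AE x in lebesgue. r (l, x) = R (F (l, x))"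
        using AE_completion[OF elim] by (auto elim: eventually_mono)
      ultimately show ?case by (rule borel_measurable_AE)
    qed
  qed
  have "AE l in lborel. (\<lambda>x. F (l, x)) \<in> borel_measurable lebesgue"
    using slice[of Re] slice[of Im] borel_measurable_continuous_onI[OF continuous_on_Re[OF continuous_on_id]]
      borel_measurable_continuous_onI[OF continuous_on_Im[OF continuous_on_id]]
    by (auto simp: borel_measurable_complex_iff elim: eventually_elim2)
  then have "AE l in lebesgue. (\<lambda>x. F (l, x)) \<in> borel_measurable lebesgue" by (rule AE_completion)
  then have "AE l in lebesgue_on I. (\<lambda>x. F (l, x)) \<in> borel_measurable lebesgue"
    using I by (auto simp: AE_restrict_space_iff elim: eventually_mono)
  moreover have "AE l in lebesgue_on I. l \<in> I"
    using I by (auto simp: AE_restrict_space_iff)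
  ultimately show ?thesis
  proof eventually_elim
    case (elim l)
    have "(\<lambda>x. F (l, x)) \<in> borel_measurable (lebesgue_on T)"
      using elim(1) by (rule measurable_restrict_space1)
    then show ?case
      by (rule measurable_cong[THEN iffD1, rotated]) (use elim(2) in \<open>auto simp: F_def space_restrict_space\<close>)
  qed
qed

lemma integrable_times_bounded:
  fixes g h :: "'a \<Rightarrow> complex"
  assumes "integrable M g" "h \<in> borel_measurable M" "\<And>x. x \<in> space M \<Longrightarrow> norm (h x) \<le> B"
  shows "integrable M (\<lambda>x. g x * h x)"
proof (rule Bochner_Integration.integrable_bound)
  show "integrable M (\<lambda>x. B *\<^sub>R norm (g x))" using assms(1) by simp
  show "(\<lambda>x. g x * h x) \<in> borel_measurable M" using assms by auto
  show "AE x in M. norm (g x * h x) \<le> norm (B *\<^sub>R norm (g x))"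
  proof (rule AE_I2)
    fix x assume "x \<in> space M"
    then have "norm (g x) * norm (h x) \<le> norm (g x) * \<bar>B\<bar>"
      using assms(3)[of x] by (intro mult_left_mono) auto
    then show "norm (g x * h x) \<le> norm (B *\<^sub>R norm (g x))" by (simp add: norm_mult abs_mult mult.commute)
  qed
qed

section \<open>Dyadic chaining\<close>

text \<open>An interval between nodes of level \<open>m + 1\<close> is an interval between nodes of
  level \<open>m\<close> plus at most one finer cell at each end. So at most two cells per level are
  used, all of them inside the given interval.\<close>

lemma dyadic_chaining:
  fixes X :: "nat \<Rightarrow> nat \<Rightarrow> real" and H :: "real \<Rightarrow> complex"
  assumes mono: "\<And>m i j. 1 \<le> i \<Longrightarrow> i \<le> j \<Longrightarrow> j < 2 ^ m \<Longrightarrow> X m i \<le> X m j"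
    and refine: "\<And>m j. 1 \<le> j \<Longrightarrow> j < 2 ^ m \<Longrightarrow> X (Suc m) (2 * j) = X m j"
    and cell: "\<And>m j. 1 \<le> j \<Longrightarrow> Suc j < 2 ^ m \<Longrightarrow> s \<le> X m j \<Longrightarrow> X m (Suc j) \<le> t \<Longrightarrow>
        norm (H (X m (Suc j)) - H (X m j)) \<le> B * \<theta> ^ m"
    and B: "0 \<le> B" "0 \<le> \<theta>"
    and ij: "1 \<le> i" "i \<le> j" "j < 2 ^ m" "s \<le> X m i" "X m j \<le> t"
  shows "norm (H (X m j) - H (X m i)) \<le> 2 * B * (\<Sum>k\<le>m. \<theta> ^ k)"
  using ij
proof (induction m arbitrary: i j)
  case 0
  then show ?case by simp
next
  case (Suc m)
  show ?case
  proof (cases "i = j")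
    case True
    then show ?thesis using B by (simp add: sum_nonneg)
  next
    case False
    then have lt: "i < j" using Suc.prems by simp
    \<comment> \<open>\<open>i\<close> is rounded up and \<open>j\<close> down to even indices, the
      nodes inherited from the coarser level. Rounding inwards keeps the coarse interval inside the
      fine one.\<close>
    define i' j' where "i' = (i + 1) div 2" and "j' = j div 2"
    have ij': "1 \<le> i'" "i' \<le> j'" "j' < 2 ^ m" "i \<le> 2 * i'" "2 * i' \<le> j" "2 * j' \<le> j" "i \<le> 2 * j'" "2 * i' < 2 ^ Suc m"
      using lt Suc.prems(1,3) by (auto simp: i'_def j'_def)
    have Xi: "X (Suc m) (2 * i') = X m i'" and Xj: "X (Suc m) (2 * j') = X m j'"
      using ij' by (auto intro!: refine)
    have "X (Suc m) i \<le> X m i'" "X m j' \<le> X (Suc m) j"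
      unfolding Xi[symmetric] Xj[symmetric] using Suc.prems ij' by (auto intro!: mono)
    then have IH: "norm (H (X m j') - H (X m i')) \<le> 2 * B * (\<Sum>k\<le>m. \<theta> ^ k)"
      using Suc.prems ij' by (intro Suc.IH) auto
    have left: "norm (H (X m i') - H (X (Suc m) i)) \<le> B * \<theta> ^ Suc m"
    proof (cases "even i")
      case True
      then have "2 * i' = i" by (auto simp: i'_def elim: evenE)
      then show ?thesis using Xi B by simp
    next
      case False
      then have e: "2 * i' = Suc i" by (auto simp: i'_def elim: oddE)
      then have "Suc i \<le> j" using ij' by simp
      then have "X (Suc m) (Suc i) \<le> X (Suc m) j" using Suc.prems by (intro mono) auto
      moreover have "Suc i < 2 ^ Suc m" using ij'(8) e by simp
      ultimately show ?thesis unfolding Xi[symmetric] e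
        using cell[OF Suc.prems(1) _ Suc.prems(4)] Suc.prems(5) by (meson order.trans)
    qed
    have right: "norm (H (X (Suc m) j) - H (X m j')) \<le> B * \<theta> ^ Suc m"
    proof (cases "even j")
      case True
      then have "2 * j' = j" by (auto simp: j'_def elim: evenE)
      then show ?thesis using Xj B by simp
    next
      case False
      then have e: "j = Suc (2 * j')" by (auto simp: j'_def elim: oddE)
      have "X (Suc m) i \<le> X (Suc m) (2 * j')" using Suc.prems ij' by (intro mono) auto
      then show ?thesis unfolding Xj[symmetric] e
        using Suc.prems ij' e by (intro cell) auto
    qed
    have "H (X (Suc m) j) - H (X (Suc m) i) = (H (X (Suc m) j) - H (X m j'))
        + ((H (X m j') - H (X m i')) + (H (X m i') - H (X (Suc m) i)))" by simp
    also have "norm \<dots> \<le> B * \<theta> ^ Suc m + (2 * B * (\<Sum>k\<le>m. \<theta> ^ k) + B * \<theta> ^ Suc m)"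
      by (intro order.trans[OF norm_triangle_ineq] add_mono left right IH)
    finally show ?thesis by (simp add: algebra_simps)
  qed
qed

text \<open>\<open>\<phi>\<close> is a cumulative mass with strictly positive density,
  \<open>\<psi>\<close> a right inverse on the open range \<open>(0, M)\<close>. The total mass
  \<open>M\<close> is not attained at any finite point, so only the indices \<open>1 \<le> j\<close>
  and \<open>j < 2 ^ m\<close> denote genuine nodes.\<close>

locale mass_grid =
  fixes \<phi> \<psi> :: "real \<Rightarrow> real" and M :: real
  assumes M: "0 < M"
    and phi_less: "0 \<le> s \<Longrightarrow> s < t \<Longrightarrow> \<phi> s < \<phi> t"
    and phi_0: "\<phi> 0 = 0"
    and phi_M: "0 \<le> s \<Longrightarrow> \<phi> s < M"
    and psi_pos: "0 < y \<Longrightarrow> y < M \<Longrightarrow> 0 < \<psi> y"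
    and phi_psi: "0 < y \<Longrightarrow> y < M \<Longrightarrow> \<phi> (\<psi> y) = y"
begin

definition X :: "nat \<Rightarrow> nat \<Rightarrow> real" where
  "X m j = \<psi> (M * real j / 2 ^ m)"

lemma phi_less_iff: "0 \<le> s \<Longrightarrow> 0 \<le> t \<Longrightarrow> \<phi> s < \<phi> t \<longleftrightarrow> s < t"
  using phi_less[of s t] phi_less[of t s] by (cases s t rule: linorder_cases) auto

lemma level:
  assumes "1 \<le> j" "j < 2 ^ m"
  shows "0 < M * real j / 2 ^ m" "M * real j / 2 ^ m < M"
proof -
  have "real j < 2 ^ m" using assms(2) by (metis of_nat_less_iff of_nat_numeral of_nat_power)
  then show "0 < M * real j / 2 ^ m" "M * real j / 2 ^ m < M"
    using assms(1) M by (auto simp: field_simps)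
qed

lemma X_pos: "1 \<le> j \<Longrightarrow> j < 2 ^ m \<Longrightarrow> 0 < X m j"
  unfolding X_def by (intro psi_pos level)

lemma phi_X: "1 \<le> j \<Longrightarrow> j < 2 ^ m \<Longrightarrow> \<phi> (X m j) = M * real j / 2 ^ m"
  unfolding X_def by (intro phi_psi level)

lemma X_less:
  assumes "1 \<le> i" "i < j" "j < 2 ^ m"
  shows "X m i < X m j"
proof -
  have "\<phi> (X m i) < \<phi> (X m j)"
    using assms M by (simp add: phi_X divide_strict_right_mono)
  then show ?thesis using X_pos[of i m] X_pos[of j m] assms by (simp add: phi_less_iff)
qed

lemma X_mono: "1 \<le> i \<Longrightarrow> i \<le> j \<Longrightarrow> j < 2 ^ m \<Longrightarrow> X m i \<le> X m j"
  using X_less[of i j m] by (cases "i = j") auto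

lemma X_refine: "X (Suc m) (2 * j) = X m j"
  by (simp add: X_def)

lemma grid_dense:
  assumes st: "0 \<le> s" "s < s'" "s' < t'" "t' < t"
  obtains m i j where "1 \<le> i" "i \<le> j" "j < 2 ^ m" "s < X m i" "X m i < s'" "t' < X m j" "X m j < t"
proof -
  define d where "d = min (\<phi> s' - \<phi> s) (\<phi> t - \<phi> t')"
  have d: "0 < d" using phi_less st by (auto simp: d_def)
  obtain m :: nat where "M / d < 2 ^ m" using real_arch_pow[of 2 "M / d"] by auto
  then have m: "M / 2 ^ m < d" using d by (simp add: field_simps)
  define h where "h = M / 2 ^ m"
  have h: "0 < h" "h < d" using M m by (auto simp: h_def)
  \<comment> \<open>The first level strictly above \<open>\<phi> s\<close> and the last one strictly
    below \<open>\<phi> t\<close>. Floor plus one and ceiling minus one give strict inequalities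
    even when these values are themselves levels.\<close>
  define i where "i = nat (\<lfloor>\<phi> s / h\<rfloor> + 1)"
  define j where "j = nat (\<lceil>\<phi> t / h\<rceil> - 1)"
  have p0: "0 \<le> \<phi> s" "0 < \<phi> t" using phi_less[of 0 s] phi_less[of 0 t] phi_0 st by (cases "s = 0"; auto)+
  have "0 \<le> \<lfloor>\<phi> s / h\<rfloor>" using p0 h by simp
  then have i1: "1 \<le> i" and ri: "real i = of_int \<lfloor>\<phi> s / h\<rfloor> + 1" unfolding i_def by linarith+
  have "\<phi> s / h < real i" "real i \<le> \<phi> s / h + 1" unfolding ri by linarith+
  then have i: "\<phi> s < h * real i" "h * real i \<le> \<phi> s + h" using h by (auto simp: field_simps)
  have "0 < \<lceil>\<phi> t / h\<rceil>" using p0 h by simp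
  then have rj: "real j = of_int \<lceil>\<phi> t / h\<rceil> - 1" by (simp add: j_def)
  have "real j < \<phi> t / h" "\<phi> t / h - 1 \<le> real j" unfolding rj by linarith+
  then have j: "h * real j < \<phi> t" "\<phi> t - h \<le> h * real j" using h by (auto simp: field_simps)
  have "h * real i < \<phi> s'" "\<phi> t' < h * real j" using i j h by (auto simp: d_def)
  moreover have "\<phi> s' < \<phi> t'" using phi_less st by simp
  ultimately have ij: "h * real i < \<phi> s'" "\<phi> t' < h * real j" "h * real i < h * real j" by auto
  then have "i < j" using h by simp
  have "h * real j < M" using j phi_M[of t] st by simp
  then have "real j < 2 ^ m" using M by (simp add: h_def field_simps)
  then have j2: "j < 2 ^ m" by (metis of_nat_less_iff of_nat_numeral of_nat_power)
  have X: "\<phi> (X m i) = h * real i" "\<phi> (X m j) = h * real j"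
    using i1 \<open>i < j\<close> j2 by (auto simp: phi_X h_def)
  have pos: "0 < X m i" "0 < X m j" using i1 \<open>i < j\<close> j2 by (auto intro!: X_pos)
  show thesis
  proof (rule that[OF i1 _ j2])
    show "i \<le> j" using \<open>i < j\<close> by simp
    show "s < X m i" "X m i < s'" "t' < X m j" "X m j < t"
      using ij i j X pos st by (auto simp: phi_less_iff[symmetric])
  qed
qed

text \<open>The two outermost cells of each level reach 0 or infinity and are left out: the L2 bound
  is available only for functions supported in a compact subset of the open half line. Finer levels
  still approximate every point, by \<open>grid_dense\<close>.\<close>

definition cells :: "nat \<Rightarrow> real \<Rightarrow> real \<Rightarrow> nat set" where
  "cells m s t = {j. 1 \<le> j \<and> Suc j < 2 ^ m \<and> s \<le> X m j \<and> X m (Suc j) \<le> t}"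

lemma cells_subset: "cells m s t \<subseteq> {..<2 ^ m}"
  by (auto simp: cells_def)

lemma finite_cells: "finite (cells m s t)"
  by (rule finite_subset[OF cells_subset]) simp

text \<open>Chaining between nodes gives a geometric series in \<open>\<theta>\<close>. Nodes can be
  chosen arbitrarily close to \<open>s\<close> and \<open>t\<close>, from inside, and continuity of
  \<open>H\<close> closes the gap, also at \<open>s = 0\<close>.\<close>

lemma increment_bound:
  fixes H :: "real \<Rightarrow> complex"
  assumes H: "continuous_on {0..} H" and st: "0 \<le> s" "s \<le> t"
    and cell: "\<And>m j. j \<in> cells m s t \<Longrightarrow> norm (H (X m (Suc j)) - H (X m j)) \<le> B * \<theta> ^ m"
    and B: "0 \<le> B" "0 \<le> \<theta>" "\<theta> < 1"
  shows "norm (H t - H s) \<le> 2 * B / (1 - \<theta>)"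
proof (cases "s = t")
  case True
  then show ?thesis using B by simp
next
  case False
  then have lt: "s < t" using st by simp
  have grid: "norm (H (X m j) - H (X m i)) \<le> 2 * B / (1 - \<theta>)"
    if ij: "1 \<le> i" "i \<le> j" "j < 2 ^ m" "s \<le> X m i" "X m j \<le> t" for m i j
  proof -
    have "norm (H (X m j) - H (X m i)) \<le> 2 * B * (\<Sum>k\<le>m. \<theta> ^ k)"
      by (rule dyadic_chaining[OF X_mono X_refine _ B(1,2) ij]) (auto intro: cell simp: cells_def)
    also have "(\<Sum>k\<le>m. \<theta> ^ k) \<le> (\<Sum>k. \<theta> ^ k)"
      using B by (intro sum_le_suminf summable_geometric) auto
    also have "(\<Sum>k. \<theta> ^ k) = 1 / (1 - \<theta>)" using B by (intro suminf_geometric) auto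
    finally show ?thesis using B by (simp add: mult_left_mono)
  qed
  show ?thesis
  proof (rule field_le_epsilon)
    fix e :: real assume e: "0 < e"
    obtain d1 where d1: "0 < d1" "\<And>x. 0 \<le> x \<Longrightarrow> dist x s < d1 \<Longrightarrow> dist (H x) (H s) < e / 2"
      using H st e unfolding continuous_on_iff by (metis atLeast_iff half_gt_zero)
    obtain d2 where d2: "0 < d2" "\<And>x. 0 \<le> x \<Longrightarrow> dist x t < d2 \<Longrightarrow> dist (H x) (H t) < e / 2"
      using H st e unfolding continuous_on_iff by (metis atLeast_iff half_gt_zero order_trans)
    define d where "d = min (min d1 d2) ((t - s) / 3)"
    have d: "0 < d" "d \<le> d1" "d \<le> d2" using d1 d2 lt by (auto simp: d_def)
    have "d \<le> (t - s) / 3" unfolding d_def by (rule min.cobounded2)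
    then have d3: "s + d < t - d" using lt by (simp add: field_simps)
    obtain m i j where ij: "1 \<le> i" "i \<le> j" "j < 2 ^ m" "s < X m i" "X m i < s + d" "t - d < X m j" "X m j < t"
      by (rule grid_dense[of s "s + d" "t - d" t]) (use st d d3 in auto)
    have "dist (H (X m i)) (H s) < e / 2" "dist (H (X m j)) (H t) < e / 2"
      using d1(2)[of "X m i"] d2(2)[of "X m j"] ij d d3 st by (simp_all add: dist_real_def)
    moreover have "norm (H (X m j) - H (X m i)) \<le> 2 * B / (1 - \<theta>)" using ij by (intro grid) auto
    moreover have "norm (H t - H s) \<le> dist (H (X m j)) (H t) + norm (H (X m j) - H (X m i)) + dist (H (X m i)) (H s)"
      by (smt (verit) dist_commute dist_norm dist_triangle)
    ultimately show "norm (H t - H s) \<le> 2 * B / (1 - \<theta>) + e" by linarith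
  qed
qed

text \<open>Counting only the cells contained in \<open>[s, t]\<close> gives superadditivity for
  free: no cell lies in both of two adjacent intervals, and those straddling the common endpoint can
  only help the union.\<close>

definition cell_sum :: "(nat \<Rightarrow> nat \<Rightarrow> real) \<Rightarrow> real \<Rightarrow> real \<Rightarrow> real" where
  "cell_sum c s t = (\<Sum>m. \<Sum>j\<in>cells m s t. c m j)"

context
  fixes c :: "nat \<Rightarrow> nat \<Rightarrow> real"
  assumes c: "\<And>m j. 0 \<le> c m j" and sm: "summable (\<lambda>m. \<Sum>j<2 ^ m. c m j)"
begin

lemma cells_sum_le: "(\<Sum>j\<in>cells m s t. c m j) \<le> (\<Sum>j<2 ^ m. c m j)"
  using c by (intro sum_mono2 cells_subset) auto

lemma summable_cells: "summable (\<lambda>m. \<Sum>j\<in>cells m s t. c m j)"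
  by (rule summable_comparison_test'[OF sm, of 0]) (simp add: cells_sum_le sum_nonneg c)

lemma cell_sum_nonneg: "0 \<le> cell_sum c s t"
  unfolding cell_sum_def by (intro suminf_nonneg summable_cells sum_nonneg c)

lemma cell_sum_le: "cell_sum c s t \<le> (\<Sum>m. \<Sum>j<2 ^ m. c m j)"
  unfolding cell_sum_def by (intro suminf_le cells_sum_le summable_cells sm)

lemma cell_le_cell_sum:
  assumes "j \<in> cells m s t"
  shows "c m j \<le> cell_sum c s t"
proof -
  have "c m j \<le> (\<Sum>j\<in>cells m s t. c m j)"
    using assms by (intro member_le_sum finite_cells c) auto
  also have "\<dots> = (\<Sum>m\<in>{m}. \<Sum>j\<in>cells m s t. c m j)" by simp
  also have "\<dots> \<le> cell_sum c s t"
    unfolding cell_sum_def by (intro sum_le_suminf summable_cells) (auto intro!: sum_nonneg c)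
  finally show ?thesis .
qed

lemma cell_sum_super:
  assumes "s \<le> u" "u \<le> t"
  shows "cell_sum c s u + cell_sum c u t \<le> cell_sum c s t"
proof -
  have "cell_sum c s u + cell_sum c u t = (\<Sum>m. (\<Sum>j\<in>cells m s u. c m j) + (\<Sum>j\<in>cells m u t. c m j))"
    unfolding cell_sum_def by (rule suminf_add[OF summable_cells summable_cells])
  also have "\<dots> \<le> cell_sum c s t"
    unfolding cell_sum_def
  proof (intro suminf_le summable_add summable_cells)
    fix m
    have "cells m s u \<inter> cells m u t = {}"
    proof -
      have False if "j \<in> cells m s u" "j \<in> cells m u t" for j
        using that X_less[of j "Suc j" m] by (auto simp: cells_def)
      then show ?thesis by blast
    qed
    then have "(\<Sum>j\<in>cells m s u. c m j) + (\<Sum>j\<in>cells m u t. c m j) = (\<Sum>j\<in>cells m s u \<union> cells m u t. c m j)"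
      by (intro sum.union_disjoint[symmetric] finite_cells)
    also have "\<dots> \<le> (\<Sum>j\<in>cells m s t. c m j)"
      using assms c by (intro sum_mono2 finite_cells) (auto simp: cells_def)
    finally show "(\<Sum>j\<in>cells m s u. c m j) + (\<Sum>j\<in>cells m u t. c m j) \<le> (\<Sum>j\<in>cells m s t. c m j)" .
  qed
  finally show ?thesis .
qed

end
end

section \<open>Cells of equal mass\<close>

lemma incr_pos:
  fixes w :: "real \<Rightarrow> real"
  assumes w: "integrable halfline w" "\<And>x. 0 < w x" and st: "0 \<le> s" "s < t"
  shows "0 < incr w s t"
proof -
  have i: "integrable halfline (\<lambda>x. indicator {s..<t} x *\<^sub>R w x)"
    using w(1) by (rule integrable_halfline_indicator) simp
  have nn: "AE x in halfline. 0 \<le> indicator {s..<t} x *\<^sub>R w x"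
    using w(2) by (intro AE_I2) (simp add: less_imp_le)
  have "incr w s t \<noteq> 0"
  proof
    assume "incr w s t = 0"
    then have "AE x in halfline. indicator {s..<t} x *\<^sub>R w x = 0"
      unfolding incr_def set_lebesgue_integral_def using integral_nonneg_eq_0_iff_AE[OF i nn] by simp
    then have "AE x in halfline. x \<notin> {s..<t}"
      by eventually_elim (use w(2) in \<open>auto simp: indicator_def less_le split: if_splits\<close>)
    then have "AE x in lebesgue. x \<notin> {s<..<t}"
      using st by (auto simp: AE_restrict_space_iff elim!: eventually_mono)
    then have "{s<..<t} \<in> null_sets lebesgue"
      by (subst (asm) AE_iff_null_sets[symmetric]) auto
    then show False using st by (auto simp: null_sets_def)
  qed
  moreover have "0 \<le> incr w s t"
    unfolding incr_def set_lebesgue_integral_def by (rule integral_nonneg_AE[OF nn])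
  ultimately show ?thesis by simp
qed

lemma incr_mono:
  fixes u w :: "real \<Rightarrow> real"
  assumes "integrable halfline u" "integrable halfline w" "\<And>x. 0 < x \<Longrightarrow> u x \<le> w x"
  shows "incr u s t \<le> incr w s t"
  unfolding incr_def set_lebesgue_integral_def
proof (rule integral_mono)
  show "indicator {s..<t} x *\<^sub>R u x \<le> indicator {s..<t} x *\<^sub>R w x" if "x \<in> space halfline" for x
    using assms(3)[of x] that by (simp add: indicator_def space_restrict_space)
qed (intro integrable_halfline_indicator assms; simp)+

lemma mass_grid_exists:
  fixes u :: "real \<Rightarrow> real"
  assumes u: "integrable halfline u" "\<And>x. 0 \<le> u x"
  obtains \<phi> \<psi> M where "mass_grid \<phi> \<psi> M"
    "\<And>s t. 0 \<le> s \<Longrightarrow> s \<le> t \<Longrightarrow> incr u s t \<le> \<phi> t - \<phi> s"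
proof -
  \<comment> \<open>Without the positive weight \<open>\<phi>\<close> would be constant wherever
    \<open>f\<close> vanishes, and the nodes would not be dense.\<close>
  obtain v :: "real \<Rightarrow> real" where v: "\<And>x. 0 < v x" "integrable halfline v"
    by (rule sigma_finite_measure.obtain_positive_integrable_function[OF sigma_finite_lebesgue_on, of "{0<..}"]) auto
  define w where "w x = u x + v x" for x
  have w: "integrable halfline w" "\<And>x. 0 < w x"
    using u v by (auto simp: w_def[abs_def] add_nonneg_pos)
  define \<phi> where "\<phi> x = incr w 0 x" for x
  define M where "M = (\<integral>x. w x \<partial>halfline)"
  have diff: "\<phi> t - \<phi> s = incr w s t" if "0 \<le> s" "s \<le> t" for s t
    using incr_split[OF w(1) that] by (simp add: \<phi>_def)
  have less: "\<phi> s < \<phi> t" if "0 \<le> s" "s < t" for s t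
    using diff[of s t] incr_pos[OF w that] that by simp
  have le_M: "\<phi> t \<le> M" for t
    unfolding \<phi>_def M_def incr_def set_lebesgue_integral_def
  proof (rule integral_mono)
    show "indicator {0..<t} x *\<^sub>R w x \<le> w x" for x using w(2)[of x] by (simp add: indicator_def)
  qed (intro integrable_halfline_indicator w; simp)+
  have less_M: "\<phi> s < M" if "0 \<le> s" for s
    using less[of s "s + 1"] le_M[of "s + 1"] that by simp
  have lim: "(\<lambda>n. \<phi> (real n)) \<longlonglongrightarrow> M"
    unfolding \<phi>_def M_def incr_def set_lebesgue_integral_def
  proof (rule integral_dominated_convergence[where w=w])
    show "AE x in halfline. (\<lambda>n. indicator {0..<real n} x *\<^sub>R w x) \<longlonglongrightarrow> w x"
    proof (rule AE_I2)
      fix x assume x: "x \<in> space halfline"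
      have "eventually (\<lambda>n. indicator {0..<real n} x *\<^sub>R w x = w x) sequentially"
        using eventually_gt_at_top[of "nat \<lceil>x\<rceil>"]
      proof eventually_elim
        case (elim n)
        then have "x < real n" by linarith
        then show ?case using x by (simp add: indicator_def space_restrict_space)
      qed
      then show "(\<lambda>n. indicator {0..<real n} x *\<^sub>R w x) \<longlonglongrightarrow> w x" by (rule tendsto_eventually)
    qed
    show "AE x in halfline. norm (indicator {0..<real n} x *\<^sub>R w x) \<le> w x" for n
      using w(2) by (intro AE_I2) (simp add: indicator_def less_imp_le)
  qed (intro borel_measurable_integrable integrable_halfline_indicator w; simp)+
  \<comment> \<open>The mass tends to \<open>M\<close>, so every level below \<open>M\<close> is
    exceeded at some finite point, and the intermediate value theorem applies.\<close>
  have ex: "\<exists>x>0. \<phi> x = y" if y: "0 < y" "y < M" for y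
  proof -
    obtain n where n: "y < \<phi> (real n)"
      using order_tendstoD(1)[OF lim y(2)] by (auto simp: eventually_sequentially)
    have "continuous_on {0..real n} \<phi>"
      unfolding \<phi>_def[abs_def] using continuous_incr[OF w(1)] by (rule continuous_on_subset) simp
    moreover have "\<phi> 0 = 0" by (simp add: \<phi>_def)
    ultimately obtain x where x: "0 \<le> x" "x \<le> real n" "\<phi> x = y"
      using IVT'[of \<phi> 0 y "real n"] n y by auto
    then have "x \<noteq> 0" using y \<open>\<phi> 0 = 0\<close> by auto
    then show ?thesis using x by (intro exI[of _ x]) simp
  qed
  define \<psi> where "\<psi> y = (SOME x. 0 < x \<and> \<phi> x = y)" for y
  have psi: "0 < \<psi> y \<and> \<phi> (\<psi> y) = y" if "0 < y" "y < M" for y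
    unfolding \<psi>_def by (rule someI_ex[OF ex[OF that]])
  have "mass_grid \<phi> \<psi> M"
  proof
    show "0 < M" using less_M[of 0] by (simp add: \<phi>_def)
  qed (use less less_M psi in \<open>auto simp: \<phi>_def\<close>)
  moreover have "incr u s t \<le> \<phi> t - \<phi> s" if "0 \<le> s" "s \<le> t" for s t
    unfolding diff[OF that] by (rule incr_mono[OF u(1) w(1)]) (simp add: w_def less_imp_le v(1))
  ultimately show thesis by (rule that)
qed

text \<open>Monotone convergence makes the integral of the sum finite, hence the sum finite almost
  everywhere.\<close>

lemma AE_summable:
  fixes F :: "nat \<Rightarrow> 'a \<Rightarrow> real"
  assumes F: "\<And>m. integrable N (F m)" "\<And>m x. 0 \<le> F m x" and sm: "summable (\<lambda>m. \<integral>x. F m x \<partial>N)"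
  shows "AE x in N. summable (\<lambda>m. F m x)"
proof -
  have [measurable]: "F m \<in> borel_measurable N" for m using F(1) by auto
  have "(\<integral>\<^sup>+x. (\<Sum>m. ennreal (F m x)) \<partial>N) = (\<Sum>m. \<integral>\<^sup>+x. ennreal (F m x) \<partial>N)"
    by (rule nn_integral_suminf) measurable
  also have "\<dots> = (\<Sum>m. ennreal (\<integral>x. F m x \<partial>N))"
    by (intro suminf_cong nn_integral_eq_integral F AE_I2)
  also have "\<dots> \<noteq> top"
    by (intro ennreal_suminf_neq_top sm Bochner_Integration.integral_nonneg F)
  finally have "AE x in N. (\<Sum>m. ennreal (F m x)) \<noteq> \<infinity>"
    by (intro nn_integral_PInf_AE) (auto simp: infinity_ennreal_def)
  then show ?thesis
  proof eventually_elim
    case (elim x)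
    then show ?case
      by (intro summable_suminf_not_top F) (simp add: infinity_ennreal_def)
  qed
qed

section \<open>Truncation at a height: L2 bounds below it, L1 bounds above it\<close>

definition trunc :: "(real \<Rightarrow> complex) \<Rightarrow> real \<Rightarrow> real \<Rightarrow> real \<Rightarrow> real \<Rightarrow> complex" where
  "trunc f \<tau> s t x = (if norm (f x) \<le> \<tau> \<and> s \<le> x \<and> x < t then f x else 0)"

context
  fixes f :: "real \<Rightarrow> complex" and p :: real
  assumes f: "f \<in> Lp_space p {0<..}" and p: "1 \<le> p" "p \<le> 2"
begin

lemma f_measurable: "f \<in> borel_measurable halfline"
  using f by (simp add: Lp_space_def)

lemma f_powr_integrable: "integrable halfline (\<lambda>x. norm (f x) powr p)"
  using f by (simp add: Lp_space_def)

lemma integrable_Lp_cut: "integrable halfline (\<lambda>x. f x * indicator {..<D} x)"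
proof (rule Bochner_Integration.integrable_bound)
  have "integrable lebesgue (indicator {0<..<D} :: real \<Rightarrow> real)"
    using emeasure_bounded_finite[of "{0<..<D}"] bounded_subset[OF bounded_closed_interval[of 0 D], of "{0<..<D}"]
    by (simp add: integrable_indicator_iff greaterThanLessThan_subseteq_atLeastAtMost_iff)
  moreover have "(\<lambda>x. indicator {0<..} x *\<^sub>R indicator {..<D} x :: real) = indicator {0<..<D}"
    by (simp add: fun_eq_iff indicator_def)
  ultimately have "integrable halfline (indicator {..<D} :: real \<Rightarrow> real)"
    by (subst integrable_restrict_space) simp_all
  then show "integrable halfline (\<lambda>x. indicator {..<D} x + norm (f x) powr p)"
    using f_powr_integrable by (rule Bochner_Integration.integrable_add)
  show "(\<lambda>x. f x * indicator {..<D} x) \<in> borel_measurable halfline"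
    by (intro borel_measurable_times f_measurable measurable_halfline) simp
  show "AE x in halfline. norm (f x * indicator {..<D} x) \<le> norm (indicator {..<D} x + norm (f x) powr p)"
  proof (rule AE_I2)
    fix x
    have "norm (f x) \<le> 1 + norm (f x) powr p"
    proof (cases "norm (f x) \<le> 1")
      case True
      moreover have "0 \<le> norm (f x) powr p" by simp
      ultimately show ?thesis by linarith
    next
      case False
      have "norm (f x) = norm (f x) powr 1" by (rule powr_one[symmetric]) simp
      also have "\<dots> \<le> norm (f x) powr p" by (rule powr_mono[OF p(1)]) (use False in simp)
      also have "\<dots> \<le> 1 + norm (f x) powr p" by simp
      finally show ?thesis .
    qed
    then show "norm (f x * indicator {..<D} x) \<le> norm (indicator {..<D} x + norm (f x) powr p)"
      by (cases "x < D") simp_all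
  qed
qed

lemma trunc_measurable: "trunc f \<tau> s t \<in> borel_measurable halfline"
proof -
  have "{x \<in> space halfline. norm (f x) \<le> \<tau>} \<in> sets halfline"
    using f_measurable by (intro borel_measurable_le) simp_all
  moreover have "{s..<t} \<inter> {0<..} \<in> sets halfline"
    by (rule sets_halfline) simp
  ultimately have "{x \<in> space halfline. norm (f x) \<le> \<tau>} \<inter> ({s..<t} \<inter> {0<..}) \<in> sets halfline"
    by (rule sets.Int)
  moreover have "{x \<in> space halfline. norm (f x) \<le> \<tau>} \<inter> ({s..<t} \<inter> {0<..})
      = {x \<in> space halfline. norm (f x) \<le> \<tau> \<and> s \<le> x \<and> x < t}"
    by (auto simp: space_restrict_space)
  ultimately have *: "{x \<in> space halfline. norm (f x) \<le> \<tau> \<and> s \<le> x \<and> x < t} \<in> sets halfline"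
    by (simp only:)
  show ?thesis
    unfolding trunc_def[abs_def] by (rule measurable_If[OF f_measurable _ *]) (rule borel_measurable_const)
qed

text \<open>Below the height \<open>\<tau>\<close> the surplus power \<open>2 - p\<close> of
  \<open>norm (f x)\<close> is at most \<open>\<tau> powr (2 - p)\<close>.\<close>

lemma trunc_in_L2:
  assumes \<tau>: "0 < \<tau>"
  shows "trunc f \<tau> s t \<in> Lp_space 2 {0<..}"
    and "(\<integral>x. norm (trunc f \<tau> s t x) powr 2 \<partial>halfline) \<le> \<tau> powr (2 - p) * incr (\<lambda>x. norm (f x) powr p) s t"
proof -
  have le: "norm (trunc f \<tau> s t x) powr 2 \<le> indicator {s..<t} x *\<^sub>R (\<tau> powr (2 - p) * norm (f x) powr p)" for x
  proof (cases "norm (f x) \<le> \<tau> \<and> s \<le> x \<and> x < t \<and> f x \<noteq> 0")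
    case True
    have "norm (f x) powr 2 = norm (f x) powr (2 - p) * norm (f x) powr p"
      by (simp flip: powr_add)
    also have "\<dots> \<le> \<tau> powr (2 - p) * norm (f x) powr p"
      using True p by (intro mult_right_mono powr_mono2) auto
    finally show ?thesis using True by (simp add: trunc_def indicator_def)
  qed (auto simp: trunc_def indicator_def)
  have i: "integrable halfline (\<lambda>x. indicator {s..<t} x *\<^sub>R (\<tau> powr (2 - p) * norm (f x) powr p))"
    by (intro integrable_halfline_indicator integrable_mult_right f_powr_integrable) simp
  have i2: "integrable halfline (\<lambda>x. norm (trunc f \<tau> s t x) powr 2)"
  proof (rule Bochner_Integration.integrable_bound[OF i])
    show "(\<lambda>x. norm (trunc f \<tau> s t x) powr 2) \<in> borel_measurable halfline"
      by (rule measurable_compose[OF trunc_measurable, of "\<lambda>z. norm z powr 2"]) measurable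
    show "AE x in halfline. norm (norm (trunc f \<tau> s t x) powr 2) \<le> norm (indicator {s..<t} x *\<^sub>R (\<tau> powr (2 - p) * norm (f x) powr p))"
      using le by (intro AE_I2) (simp add: order.trans[OF _ abs_ge_self])
  qed
  then show "trunc f \<tau> s t \<in> Lp_space 2 {0<..}"
    using trunc_measurable by (simp add: Lp_space_def)
  have "(\<integral>x. norm (trunc f \<tau> s t x) powr 2 \<partial>halfline) \<le> (\<integral>x. indicator {s..<t} x *\<^sub>R (\<tau> powr (2 - p) * norm (f x) powr p) \<partial>halfline)"
    by (intro integral_mono i i2 le)
  also have "\<dots> = \<tau> powr (2 - p) * incr (\<lambda>x. norm (f x) powr p) s t"
    unfolding incr_def set_lebesgue_integral_def
    by (subst integral_mult_right_zero[symmetric]) (simp add: mult.left_commute)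
  finally show "(\<integral>x. norm (trunc f \<tau> s t x) powr 2 \<partial>halfline) \<le> \<tau> powr (2 - p) * incr (\<lambda>x. norm (f x) powr p) s t" .
qed

lemma trunc_compactly_supported:
  assumes "0 < s"
  shows "compactly_supported_in {0<..} (trunc f \<tau> s t)"
  unfolding compactly_supported_in_def
  by (intro exI[of _ "{s..t}"]) (use assms in \<open>auto simp: trunc_def\<close>)

text \<open>Only the part of \<open>f\<close> above \<open>\<tau>\<close> survives in the
  difference. There the exponent \<open>1 - p \<le> 0\<close> gives
  \<open>norm (f x) \<le> \<tau> powr (1 - p) * norm (f x) powr p\<close>, and the kernel is bounded
  by \<open>B\<close>.\<close>

lemma incr_minus_trunc:
  assumes \<tau>: "0 < \<tau>" and h: "\<kappa> l \<in> borel_measurable halfline" "\<And>x. 0 < x \<Longrightarrow> norm (\<kappa> l x) \<le> B"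
  shows "norm (incr (\<lambda>x. f x * \<kappa> l x) s t - kernel_op \<kappa> (trunc f \<tau> s t) l)
           \<le> B * \<tau> powr (1 - p) * incr (\<lambda>x. norm (f x) powr p) s t"
proof -
  have B0: "0 \<le> B" using h(2)[of 1] norm_ge_zero[of "\<kappa> l 1"] by linarith
  have i0: "integrable halfline (\<lambda>x. (f x * indicator {..<t} x) * \<kappa> l x)"
    by (rule integrable_times_bounded[OF integrable_Lp_cut h(1), where B=B])
       (simp add: h(2) space_restrict_space)
  have i1: "integrable halfline (\<lambda>x. indicator {s..<t} x *\<^sub>R (f x * \<kappa> l x))"
  proof -
    have "(\<lambda>x. indicator {s..<t} x *\<^sub>R (f x * \<kappa> l x)) = (\<lambda>x. indicator {s..<t} x *\<^sub>R ((f x * indicator {..<t} x) * \<kappa> l x))"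
      by (auto simp: indicator_def)
    then show ?thesis using integrable_halfline_indicator[OF i0, of "{s..<t}"] by simp
  qed
  have i2: "integrable halfline (\<lambda>x. \<kappa> l x * trunc f \<tau> s t x)"
  proof (rule Bochner_Integration.integrable_bound[OF i1])
    show "(\<lambda>x. \<kappa> l x * trunc f \<tau> s t x) \<in> borel_measurable halfline"
      by (intro borel_measurable_times h trunc_measurable)
  qed (auto simp: trunc_def indicator_def norm_mult)
  have i3: "integrable halfline (\<lambda>x. indicator {s..<t} x *\<^sub>R (B * \<tau> powr (1 - p) * norm (f x) powr p))"
    by (intro integrable_halfline_indicator integrable_mult_right f_powr_integrable) simp
  have eq: "incr (\<lambda>x. f x * \<kappa> l x) s t - kernel_op \<kappa> (trunc f \<tau> s t) l =
      (\<integral>x. indicator {s..<t} x *\<^sub>R (f x * \<kappa> l x) - \<kappa> l x * trunc f \<tau> s t x \<partial>halfline)"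
    unfolding incr_def set_lebesgue_integral_def kernel_op_def
    by (rule Bochner_Integration.integral_diff[OF i1 i2, symmetric])
  have "norm (incr (\<lambda>x. f x * \<kappa> l x) s t - kernel_op \<kappa> (trunc f \<tau> s t) l)
      \<le> (\<integral>x. norm (indicator {s..<t} x *\<^sub>R (f x * \<kappa> l x) - \<kappa> l x * trunc f \<tau> s t x) \<partial>halfline)"
    unfolding eq by (rule integral_norm_bound)
  also have "\<dots> \<le> (\<integral>x. indicator {s..<t} x *\<^sub>R (B * \<tau> powr (1 - p) * norm (f x) powr p) \<partial>halfline)"
  proof (rule integral_mono)
    show "integrable halfline (\<lambda>x. indicator {s..<t} x *\<^sub>R (B * \<tau> powr (1 - p) * norm (f x) powr p))"
      by (rule i3)
    show "integrable halfline (\<lambda>x. norm (indicator {s..<t} x *\<^sub>R (f x * \<kappa> l x) - \<kappa> l x * trunc f \<tau> s t x))"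
      by (rule integrable_norm[OF Bochner_Integration.integrable_diff[OF i1 i2]])
    fix x assume "x \<in> space halfline"
    then have x: "0 < x" by (simp add: space_restrict_space)
    show "norm (indicator {s..<t} x *\<^sub>R (f x * \<kappa> l x) - \<kappa> l x * trunc f \<tau> s t x)
        \<le> indicator {s..<t} x *\<^sub>R (B * \<tau> powr (1 - p) * norm (f x) powr p)"
    proof (cases "s \<le> x \<and> x < t \<and> \<not> norm (f x) \<le> \<tau>")
      case True
      have "norm (f x) = norm (f x) powr (1 - p) * norm (f x) powr p"
        using True \<tau> by (simp flip: powr_add)
      also have "\<dots> \<le> \<tau> powr (1 - p) * norm (f x) powr p"
        using True \<tau> p by (intro mult_right_mono powr_mono2') auto
      finally have "norm (\<kappa> l x) * norm (f x) \<le> B * (\<tau> powr (1 - p) * norm (f x) powr p)"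
        using h(2)[OF x] B0 by (intro mult_mono) auto
      then show ?thesis using True by (simp add: trunc_def indicator_def norm_mult mult_ac)
    next
      case False
      then show ?thesis using B0 by (auto simp: trunc_def indicator_def)
    qed
  qed
  also have "\<dots> = B * \<tau> powr (1 - p) * incr (\<lambda>x. norm (f x) powr p) s t"
    unfolding incr_def set_lebesgue_integral_def
    by (subst integral_mult_right_zero[symmetric]) (simp add: mult.left_commute)
  finally show ?thesis .
qed

end

section \<open>Almost everywhere existence of a control\<close>

lemma norm_powr_2: "norm (z::complex) powr 2 = (norm z)\<^sup>2"
  by (cases "z = 0") auto

text \<open>Lets one weight \<open>1 + u\<^sup>2\<close> dominate, to the power \<open>q\<close>,
  both the constant L1 contribution of a cell and its L2 contribution \<open>u\<close>.\<close>

lemma max_1_le_powr: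
  fixes u :: real
  assumes "0 \<le> u" "1/2 \<le> q"
  shows "1 \<le> (1 + u\<^sup>2) powr q" "u \<le> (1 + u\<^sup>2) powr q"
proof -
  show 1: "1 \<le> (1 + u\<^sup>2) powr q" using assms by (intro ge_one_powr_ge_zero) auto
  have "u \<le> sqrt (1 + u\<^sup>2)" by (rule real_le_rsqrt) simp
  also have "\<dots> = (1 + u\<^sup>2) powr (1/2)" by (rule powr_half_sqrt[symmetric]) simp
  also have "\<dots> \<le> (1 + u\<^sup>2) powr q" using assms by (intro powr_mono) auto
  finally show "u \<le> (1 + u\<^sup>2) powr q" .
qed

lemma L2_bound_of_norm_bound:
  assumes "Lp_norm 2 I b \<le> C * Lp_norm 2 J g"
  shows "(\<integral>x. norm (b x) powr 2 \<partial>lebesgue_on I) \<le> C\<^sup>2 * (\<integral>x. norm (g x) powr 2 \<partial>lebesgue_on J)"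
proof -
  define P Q where "P = (\<integral>x. norm (b x) powr 2 \<partial>lebesgue_on I)" and "Q = (\<integral>x. norm (g x) powr 2 \<partial>lebesgue_on J)"
  have PQ: "0 \<le> P" "0 \<le> Q" unfolding P_def Q_def by (auto intro!: Bochner_Integration.integral_nonneg)
  have "sqrt P \<le> C * sqrt Q"
    using assms PQ unfolding Lp_norm_def P_def[symmetric] Q_def[symmetric] by (simp add: powr_half_sqrt)
  then have "(sqrt P)\<^sup>2 \<le> (C * sqrt Q)\<^sup>2" using PQ by (intro power_mono) auto
  then show ?thesis using PQ by (simp add: power_mult_distrib P_def Q_def)
qed

text \<open>\<open>\<sigma> = 2 powr (-1/p)\<close> is the ratio of truncation heights between
  levels. \<open>2 * \<alpha> < 1\<close> makes weights \<open>\<alpha> ^ m\<close> summable over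
  \<open>2 ^ m\<close> cells, and \<open>\<sigma> < \<alpha> powr q\<close> leaves a decaying ratio
  for chaining. Such an \<open>\<alpha>\<close> lies between \<open>2 powr (-1/(p*q))\<close> and
  1/2, an interval that is nonempty because \<open>p * q < 1\<close>.\<close>

lemma exists_scale:
  fixes p q :: real
  assumes p: "1 \<le> p" and q: "1/2 < q" "p * q < 1"
  obtains \<sigma> \<alpha> :: real where "0 < \<sigma>" "\<sigma> powr p = 1/2" "0 < \<alpha>" "2 * \<alpha> < 1" "\<sigma> < \<alpha> powr q"
proof -
  define \<sigma> :: real where "\<sigma> = 2 powr (-1/p)"
  have pq: "0 < p * q" using p q by simp
  have "1 / 1 < 1 / (p * q)" using pq q(2) by (intro divide_strict_left_mono) auto
  then have "(2::real) powr (-1/(p*q)) < 2 powr (-1)" by (intro powr_less_mono) auto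
  then obtain \<alpha> where \<alpha>: "2 powr (-1/(p*q)) < \<alpha>" "\<alpha> < 1/2"
    using dense[of "2 powr (-1/(p*q))" "1/2"] by (auto simp: powr_minus)
  have \<alpha>0: "0 < \<alpha>" using \<alpha>(1) powr_gt_zero[of 2 "-1/(p*q)"] by linarith
  have "\<sigma> powr p = 1/2" using p unfolding \<sigma>_def powr_powr by (simp add: powr_minus)
  moreover have "\<sigma> < \<alpha> powr q"
  proof -
    have "-1/p = -1/(p*q) * q" using q by simp
    then have "\<sigma> = (2 powr (-1/(p*q))) powr q" unfolding \<sigma>_def powr_powr by (rule arg_cong)
    also have "\<dots> < \<alpha> powr q" using \<alpha> q by (intro powr_less_mono2) auto
    finally show ?thesis .
  qed
  ultimately show thesis using \<alpha> \<alpha>0 by (intro that[of \<sigma> \<alpha>]) (auto simp: \<sigma>_def)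
qed

text \<open>On a cell of mass \<open>M / 2^m\<close> the function is split at height \<open>\<tau>\<close> with \<open>\<tau> powr p = 1 / 2^m\<close>.
  The large part is estimated in \<open>L\<^sup>1\<close>, the small part by the \<open>L\<^sup>2\<close> bound of the operator;
  this replaces interpolation between \<open>L\<^sup>1\<close> and \<open>L\<^sup>2\<close>.\<close>

lemma AE_control:
  fixes \<kappa> :: "real \<Rightarrow> real \<Rightarrow> complex"
  assumes I: "I \<in> sets lebesgue"
    and \<kappa>m: "(\<lambda>(l, x). \<kappa> l x) \<in> borel_measurable (lebesgue_on (I \<times> {0<..}))"
    and \<kappa>b: "bounded ((\<lambda>(l, x). \<kappa> l x) ` (I \<times> {0<..}))"
    and L2: "\<And>g. g \<in> Lp_space 2 {0<..} \<Longrightarrow> compactly_supported_in {0<..} g \<Longrightarrow>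
        kernel_op \<kappa> g \<in> Lp_space 2 I \<and> Lp_norm 2 I (kernel_op \<kappa> g) \<le> C * Lp_norm 2 {0<..} g"
    and p: "1 \<le> p" "p \<le> 2" and f: "f \<in> Lp_space p {0<..}"
    and q: "1/2 < q" "p * q < 1"
  shows "AE l in lebesgue_on I. (\<forall>D. integrable halfline (\<lambda>x. f x * \<kappa> l x * indicator {..<D} x)) \<and>
     (\<exists>a \<omega> W. 0 \<le> a \<and> control \<omega> q W \<and>
       (\<forall>s t. 0 \<le> s \<longrightarrow> s \<le> t \<longrightarrow> norm (incr (\<lambda>x. f x * \<kappa> l x) s t) \<le> a * \<omega> s t powr q))"
proof -
  obtain B where B: "0 \<le> B" "\<And>l x. l \<in> I \<Longrightarrow> 0 < x \<Longrightarrow> norm (\<kappa> l x) \<le> B"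
  proof -
    obtain B where "\<forall>z\<in>(\<lambda>(l, x). \<kappa> l x) ` (I \<times> {0<..}). norm z \<le> B" using \<kappa>b by (auto simp: bounded_iff)
    then have "norm (\<kappa> l x) \<le> max B 0" if "l \<in> I" "0 < x" for l x
      using that by (force simp: le_max_iff_disj)
    then show thesis by (intro that[of "max B 0"]) auto
  qed
  define u where "u x = norm (f x) powr p" for x
  have ui: "integrable halfline u" unfolding u_def[abs_def] by (rule f_powr_integrable[OF f p])
  obtain \<phi> \<psi> M where "mass_grid \<phi> \<psi> M" and mass: "\<And>s t. 0 \<le> s \<Longrightarrow> s \<le> t \<Longrightarrow> incr u s t \<le> \<phi> t - \<phi> s"
    by (rule mass_grid_exists[OF ui]) (auto simp: u_def)
  then interpret mass_grid \<phi> \<psi> M by simp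
  obtain \<sigma> \<alpha> where \<sigma>: "0 < \<sigma>" "\<sigma> powr p = 1/2" and \<alpha>: "0 < \<alpha>" "2 * \<alpha> < 1" "\<sigma> < \<alpha> powr q"
    by (rule exists_scale[OF p(1) q])
  define \<theta> where "\<theta> = \<sigma> / \<alpha> powr q"
  have \<theta>: "0 \<le> \<theta>" "\<theta> < 1" using \<sigma> \<alpha> by (auto simp: \<theta>_def)
  define \<tau> where "\<tau> m = \<sigma> ^ m" for m
  have \<tau>: "0 < \<tau> m" for m using \<sigma> by (simp add: \<tau>_def)
  have \<tau>p: "\<tau> m powr p = 1 / 2 ^ m" for m
  proof -
    have "\<tau> m powr p = (\<sigma> powr p) ^ m" using \<sigma>(1)
      by (simp add: \<tau>_def powr_realpow[symmetric] powr_powr mult.commute)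
    then show ?thesis by (simp add: \<sigma>(2) power_one_over)
  qed
  have \<tau>1: "\<tau> m powr (1 - p) * (M / 2 ^ m) = M * \<tau> m" for m
  proof -
    have "\<tau> m powr (1 - p) * \<tau> m powr p = \<tau> m" using \<tau>[of m] by (simp flip: powr_add)
    then show ?thesis unfolding \<tau>p by (simp add: field_simps)
  qed
  have \<tau>2: "\<tau> m powr (2 - p) * (M / 2 ^ m) = M * (\<tau> m)\<^sup>2" for m
  proof -
    have "\<tau> m powr (2 - p) * \<tau> m powr p = (\<tau> m)\<^sup>2" using \<tau>[of m] by (simp flip: powr_add)
    then show ?thesis unfolding \<tau>p by (simp add: field_simps)
  qed
  define V where "V m j \<longleftrightarrow> 1 \<le> j \<and> Suc j < 2 ^ m" for m j :: nat
  have cell_mass: "incr u (X m j) (X m (Suc j)) \<le> M / 2 ^ m" if "V m j" for m j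
  proof -
    have "incr u (X m j) (X m (Suc j)) \<le> \<phi> (X m (Suc j)) - \<phi> (X m j)"
      using that X_pos[of j m] X_less[of j "Suc j" m] by (intro mass) (auto simp: V_def)
    also have "\<dots> = M / 2 ^ m"
      using that by (simp add: V_def phi_X field_simps)
    finally show ?thesis .
  qed
  define b where "b m j l = (if V m j then kernel_op \<kappa> (trunc f (\<tau> m) (X m j) (X m (Suc j))) l else 0)" for m j l
  have b: "integrable (lebesgue_on I) (\<lambda>l. norm (b m j l) powr 2) \<and>
      (\<integral>l. norm (b m j l) powr 2 \<partial>lebesgue_on I) \<le> C\<^sup>2 * (M * (\<tau> m)\<^sup>2)" for m j
  proof (cases "V m j")
    case True
    let ?g = "trunc f (\<tau> m) (X m j) (X m (Suc j))"
    have bg: "b m j = kernel_op \<kappa> ?g" using True by (simp add: b_def fun_eq_iff)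
    have "0 < X m j" using True by (intro X_pos) (auto simp: V_def)
    then have K: "kernel_op \<kappa> ?g \<in> Lp_space 2 I" "Lp_norm 2 I (kernel_op \<kappa> ?g) \<le> C * Lp_norm 2 {0<..} ?g"
      using L2[OF trunc_in_L2(1)[OF f p \<tau>] trunc_compactly_supported[OF f p]] by auto
    have "(\<integral>x. norm (?g x) powr 2 \<partial>halfline) \<le> \<tau> m powr (2 - p) * incr u (X m j) (X m (Suc j))"
      unfolding u_def by (rule trunc_in_L2(2)[OF f p \<tau>])
    also have "\<dots> \<le> \<tau> m powr (2 - p) * (M / 2 ^ m)"
      by (intro mult_left_mono cell_mass True) simp
    also have "\<dots> = M * (\<tau> m)\<^sup>2" by (rule \<tau>2)
    finally have g: "(\<integral>x. norm (?g x) powr 2 \<partial>halfline) \<le> M * (\<tau> m)\<^sup>2" .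
    have "(\<integral>l. norm (b m j l) powr 2 \<partial>lebesgue_on I) \<le> C\<^sup>2 * (\<integral>x. norm (?g x) powr 2 \<partial>halfline)"
      unfolding bg by (rule L2_bound_of_norm_bound[OF K(2)])
    also have "\<dots> \<le> C\<^sup>2 * (M * (\<tau> m)\<^sup>2)" by (intro mult_left_mono g) simp
    finally show ?thesis using K(1) by (simp add: bg Lp_space_def)
  next
    case False
    then have "b m j = (\<lambda>l. 0)" by (simp add: b_def fun_eq_iff)
    then show ?thesis using M by simp
  qed
  \<comment> \<open>Each normalised square has integral at most \<open>C\<^sup>2 * M\<close>,
    whatever the level and the cell. The weight \<open>\<alpha> ^ m\<close> and the number
    \<open>2 ^ m\<close> of cells turn this into the geometric series in
    \<open>2 * \<alpha>\<close>.\<close>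
  define F where "F m l = (\<Sum>j<(2::nat) ^ m. \<alpha> ^ m * (norm (b m j l) powr 2 / (\<tau> m)\<^sup>2))" for m l
  have Fi: "integrable (lebesgue_on I) (F m)" for m
    unfolding F_def[abs_def] by (intro Bochner_Integration.integrable_sum integrable_mult_right integrable_divide) (use b in blast)
  have F0: "0 \<le> F m l" for m l unfolding F_def using \<alpha>(1) by (intro sum_nonneg) simp
  have F_le: "(\<integral>l. F m l \<partial>lebesgue_on I) \<le> C\<^sup>2 * M * (2 * \<alpha>) ^ m" for m
  proof -
    have "(\<integral>l. F m l \<partial>lebesgue_on I) = (\<Sum>j<(2::nat) ^ m. \<alpha> ^ m * ((\<integral>l. norm (b m j l) powr 2 \<partial>lebesgue_on I) / (\<tau> m)\<^sup>2))"
      unfolding F_def using b by (subst Bochner_Integration.integral_sum) auto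
    also have "\<dots> \<le> (\<Sum>j<(2::nat) ^ m. \<alpha> ^ m * (C\<^sup>2 * M))"
    proof (intro sum_mono mult_left_mono)
      fix j
      have "(\<integral>l. norm (b m j l) powr 2 \<partial>lebesgue_on I) / (\<tau> m)\<^sup>2 \<le> C\<^sup>2 * (M * (\<tau> m)\<^sup>2) / (\<tau> m)\<^sup>2"
        using b by (intro divide_right_mono) auto
      then show "(\<integral>l. norm (b m j l) powr 2 \<partial>lebesgue_on I) / (\<tau> m)\<^sup>2 \<le> C\<^sup>2 * M"
        using \<tau>[of m] by simp
    qed (use \<alpha> in simp)
    also have "\<dots> = C\<^sup>2 * M * (2 * \<alpha>) ^ m" by (simp add: power_mult_distrib)
    finally show ?thesis .
  qed
  have sF: "summable (\<lambda>m. \<integral>l. F m l \<partial>lebesgue_on I)"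
  proof (rule summable_comparison_test'[where N=0])
    show "summable (\<lambda>m. C\<^sup>2 * M * (2 * \<alpha>) ^ m)"
      using \<alpha> by (intro summable_mult summable_geometric) simp
    show "norm (\<integral>l. F m l \<partial>lebesgue_on I) \<le> C\<^sup>2 * M * (2 * \<alpha>) ^ m" for m
      using F_le[of m] F0 by (simp add: Bochner_Integration.integral_nonneg)
  qed
  have "AE l in lebesgue_on I. summable (\<lambda>m. F m l)"
    by (rule AE_summable[OF Fi F0 sF])
  moreover have "AE l in lebesgue_on I. \<kappa> l \<in> borel_measurable halfline"
    by (rule AE_slice_measurable[OF I _ \<kappa>m]) simp
  moreover have "AE l in lebesgue_on I. l \<in> I"
    using I by (simp add: AE_restrict_space_iff)
  ultimately show ?thesis
  proof eventually_elim
    case (elim l)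
    note lI = elim(3) and \<kappa>l = elim(2)
    have int: "integrable halfline (\<lambda>x. (f x * indicator {..<D} x) * \<kappa> l x)" for D
      by (rule integrable_times_bounded[OF integrable_Lp_cut[OF f p] \<kappa>l, where B=B])
         (use B(2)[OF lI] in \<open>simp add: space_restrict_space\<close>)
    \<comment> \<open>The summand 1 pays for the large values of \<open>f\<close> on the cell, the
      square for the small ones.\<close>
    define c where "c m j = \<alpha> ^ m * (1 + norm (b m j l) powr 2 / (\<tau> m)\<^sup>2)" for m j
    have c0: "0 \<le> c m j" for m j using \<alpha> by (simp add: c_def)
    have "(\<Sum>j<2 ^ m. c m j) = (2 * \<alpha>) ^ m + F m l" for m
      by (simp add: c_def F_def distrib_left sum.distrib power_mult_distrib)
    moreover have "summable (\<lambda>m. (2 * \<alpha>) ^ m + F m l)"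
      using \<alpha> elim(1) by (intro summable_add summable_geometric) simp
    ultimately have cs: "summable (\<lambda>m. \<Sum>j<2 ^ m. c m j)" by simp
    define \<omega> where "\<omega> = cell_sum c"
    define W where "W = (\<Sum>m. \<Sum>j<2 ^ m. c m j)"
    have "control \<omega> q W"
    proof
      show "0 \<le> \<omega> s t" for s t unfolding \<omega>_def by (rule cell_sum_nonneg[OF c0 cs])
      show "\<omega> s v + \<omega> v t \<le> \<omega> s t" if "0 \<le> s" "s \<le> v" "v \<le> t" for s v t
        unfolding \<omega>_def by (rule cell_sum_super[OF c0 cs that(2,3)])
      show "\<omega> s t \<le> W" for s t unfolding \<omega>_def W_def by (rule cell_sum_le[OF c0 cs])
    qed (rule q(1))
    moreover have "norm (incr (\<lambda>x. f x * \<kappa> l x) s t) \<le> (2 * (B * M + 1) / (1 - \<theta>)) * \<omega> s t powr q"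
      if st: "0 \<le> s" "s \<le> t" for s t
    proof -
      \<comment> \<open>Since \<open>f * \<kappa> l\<close> may fail to be integrable on the half
        line, the primitive is taken of the function cut at \<open>t\<close>; on
        \<open>[0, t]\<close> the increments are unchanged.\<close>
      define H where "H v = incr (\<lambda>x. (f x * indicator {..<t} x) * \<kappa> l x) 0 v" for v
      have Hd: "H v' - H v = incr (\<lambda>x. f x * \<kappa> l x) v v'" if "0 \<le> v" "v \<le> v'" "v' \<le> t" for v v'
      proof -
        have "H v' - H v = incr (\<lambda>x. (f x * indicator {..<t} x) * \<kappa> l x) v v'"
          using incr_split[OF int[of t], of 0 v v'] that by (simp add: H_def)
        also have "\<dots> = incr (\<lambda>x. f x * \<kappa> l x) v v'"
          unfolding incr_def set_lebesgue_integral_def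
          by (rule Bochner_Integration.integral_cong) (use that in \<open>auto simp: indicator_def\<close>)
        finally show ?thesis .
      qed
      have Hc: "continuous_on {0..} H"
        unfolding H_def[abs_def] by (rule continuous_on_subset[OF continuous_incr[OF int]]) simp
      have cell: "norm (H (X m (Suc j)) - H (X m j)) \<le> ((B * M + 1) * \<omega> s t powr q) * \<theta> ^ m"
        if j: "j \<in> cells m s t" for m j
      proof -
        have V: "V m j" using j by (simp add: cells_def V_def)
        have X: "0 < X m j" "X m j \<le> X m (Suc j)" "X m (Suc j) \<le> t"
          using j X_pos[of j m] X_less[of j "Suc j" m] by (auto simp: cells_def)
        define v where "v = norm (b m j l) / \<tau> m"
        have v: "0 \<le> v" "norm (b m j l) = \<tau> m * v" using \<tau>[of m] by (auto simp: v_def)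
        let ?i = "incr (\<lambda>x. f x * \<kappa> l x) (X m j) (X m (Suc j))"
        have "norm (?i - b m j l) \<le> B * \<tau> m powr (1 - p) * incr u (X m j) (X m (Suc j))"
          unfolding u_def b_def if_P[OF V]
          by (rule incr_minus_trunc[OF f p \<tau>, where \<kappa>=\<kappa> and l=l]) (use \<kappa>l B(2)[OF lI] in auto)
        also have "\<dots> \<le> B * \<tau> m powr (1 - p) * (M / 2 ^ m)"
          using B(1) by (intro mult_left_mono cell_mass V) simp
        also have "\<dots> = B * M * \<tau> m" by (simp only: mult.assoc \<tau>1)
        finally have "norm ?i \<le> B * M * \<tau> m + \<tau> m * v"
          using norm_triangle_sub[of ?i "b m j l"] v(2) by linarith
        also have "\<dots> \<le> B * M * \<tau> m * (1 + v\<^sup>2) powr q + \<tau> m * (1 + v\<^sup>2) powr q"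
        proof (intro add_mono mult_left_mono)
          have "B * M * \<tau> m * 1 \<le> B * M * \<tau> m * (1 + v\<^sup>2) powr q"
            using max_1_le_powr(1)[OF v(1)] q(1) B(1) M \<tau>[of m] by (intro mult_left_mono) auto
          then show "B * M * \<tau> m \<le> B * M * \<tau> m * (1 + v\<^sup>2) powr q" by simp
          show "v \<le> (1 + v\<^sup>2) powr q" using max_1_le_powr(2)[OF v(1)] q(1) by simp
        qed (use \<tau>[of m] in simp)
        also have "\<dots> = (B * M + 1) * (\<tau> m * (1 + v\<^sup>2) powr q)" by (simp add: algebra_simps)
        \<comment> \<open>By the choice of \<open>\<theta>\<close>, the height
          \<open>\<tau> m\<close> is \<open>\<theta> ^ m\<close> times the power \<open>q\<close> of
          \<open>\<alpha> ^ m\<close>: one factor drives the chaining, the other is absorbed into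
          the weight \<open>c m j\<close>.\<close>
        also have "\<tau> m * (1 + v\<^sup>2) powr q = \<theta> ^ m * c m j powr q"
        proof -
          have "c m j = \<alpha> ^ m * (1 + v\<^sup>2)"
            by (simp add: c_def norm_powr_2 v_def power_divide)
          then have "c m j powr q = (\<alpha> powr q) ^ m * (1 + v\<^sup>2) powr q"
            using \<alpha>(1) by (simp add: powr_mult powr_realpow[symmetric] powr_powr mult.commute)
          then show ?thesis using \<alpha>(1) by (simp add: \<theta>_def \<tau>_def power_divide)
        qed
        also have "\<theta> ^ m * c m j powr q \<le> \<theta> ^ m * \<omega> s t powr q"
        proof (intro mult_left_mono powr_mono2)
          show "c m j \<le> \<omega> s t" unfolding \<omega>_def by (rule cell_le_cell_sum[OF c0 cs j])
        qed (use q \<theta> c0 in auto)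
        finally have "norm ?i \<le> (B * M + 1) * (\<theta> ^ m * \<omega> s t powr q)"
          using B(1) M by (simp add: mult_left_mono)
        then show ?thesis using Hd[of "X m j" "X m (Suc j)"] X by (simp add: mult_ac)
      qed
      have "norm (H t - H s) \<le> 2 * ((B * M + 1) * \<omega> s t powr q) / (1 - \<theta>)"
        by (rule increment_bound[OF Hc st cell _ \<theta>]) (use B(1) M in auto)
      then show ?thesis unfolding Hd[OF st order_refl] by (simp only: times_divide_eq_left mult.assoc)
    qed
    moreover have "0 \<le> 2 * (B * M + 1) / (1 - \<theta>)" using B(1) M \<theta> by simp
    moreover have "integrable halfline (\<lambda>x. f x * \<kappa> l x * indicator {..<D} x)" for D
      using int[of D] by (simp add: mult_ac)
    ultimately show ?case by blast
  qed
qed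

section \<open>Convergence\<close>

lemma incr_cut:
  fixes g :: "real \<Rightarrow> complex"
  shows "incr (\<lambda>x. g x * indicator {..<D} x) s t = incr g s (min t D)"
  unfolding incr_def set_lebesgue_integral_def
  by (rule Bochner_Integration.integral_cong) (auto simp: indicator_def)

lemma incr_cut_diff:
  fixes g :: "real \<Rightarrow> complex"
  assumes "D \<le> D'"
  shows "incr (\<lambda>x. g x * indicator {..<D} x - g x * indicator {..<D'} x) s t
           = - incr g (max s D) (min t D')"
proof -
  have "(\<integral>x. indicator {s..<t} x *\<^sub>R (g x * indicator {..<D} x - g x * indicator {..<D'} x) \<partial>halfline)
      = (\<integral>x. - (indicator {max s D..<min t D'} x *\<^sub>R g x) \<partial>halfline)"
    by (rule Bochner_Integration.integral_cong) (use assms in \<open>auto simp: indicator_def\<close>)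
  then show ?thesis by (simp add: incr_def set_lebesgue_integral_def)
qed

context control
begin

lemma mono:
  assumes "0 \<le> s" "s \<le> s'" "s' \<le> t'" "t' \<le> t"
  shows "\<omega> s' t' \<le> \<omega> s t"
  using super[of s s' t'] super[of s t' t] nonneg[of s s'] nonneg[of t' t] assms by linarith

text \<open>The values \<open>\<omega> 0 t\<close> are bounded; take \<open>N\<close> where they are
  within \<open>\<delta>\<close> of their supremum. Superadditivity bounds
  \<open>\<omega> N t\<close> by what is left.\<close>

lemma tail:
  assumes "0 < \<delta>"
  obtains N where "0 \<le> N" "\<And>t. N \<le> t \<Longrightarrow> \<omega> N t \<le> \<delta>"
proof -
  let ?S = "(\<lambda>t. \<omega> 0 t) ` {0..}"
  have bdd: "bdd_above ?S" using bound[of 0] by (auto intro!: bdd_aboveI[of _ W])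
  have "Sup ?S - \<delta> < Sup ?S" using assms by simp
  then obtain N where N: "0 \<le> N" "Sup ?S - \<delta> < \<omega> 0 N"
    using less_cSup_iff[OF _ bdd, of "Sup ?S - \<delta>"] by auto
  have "\<omega> N t \<le> \<delta>" if "N \<le> t" for t
  proof -
    have "\<omega> 0 t \<le> Sup ?S" using that N bdd by (intro cSup_upper) auto
    then show ?thesis using super[of 0 N t] N that by linarith
  qed
  then show thesis using N by (intro that)
qed

text \<open>Adding the rescaled tail \<open>\<omega> (max s N) (max t N) / \<delta>\<close> gives a control of bounded total size
  for which increments beyond \<open>N\<close> are small by a factor \<open>\<delta> powr q\<close>.\<close>

lemma iter_cut_Cauchy:
  fixes g :: "nat \<Rightarrow> real \<Rightarrow> complex"
  assumes int: "\<And>i D. i \<in> set L \<Longrightarrow> integrable halfline (\<lambda>x. g i x * indicator {..<D} x)"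
    and g: "\<And>i s t. i \<in> set L \<Longrightarrow> 0 \<le> s \<Longrightarrow> s \<le> t \<Longrightarrow> norm (incr (g i) s t) \<le> a * \<omega> s t powr q"
    and a: "0 \<le> a" and \<epsilon>: "0 < \<epsilon>"
  obtains N where "0 \<le> N" "\<And>D D' t. 0 \<le> t \<Longrightarrow> (\<And>i. i \<in> set L \<Longrightarrow> N \<le> D i \<and> N \<le> D' i) \<Longrightarrow>
      norm (iter (\<lambda>i x. g i x * indicator {..<D i} x) L t - iter (\<lambda>i x. g i x * indicator {..<D' i} x) L t) \<le> \<epsilon>"
proof -
  \<comment> \<open>\<open>Z\<close> has to be fixed before \<open>\<delta>\<close>. This is
    possible because the rescaled tail is at most 1, so the enlarged control has size
    \<open>W + 1\<close> for every \<open>\<delta>\<close>.\<close>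
  define Z where "Z = length L * (control.K q (W + 1) * a) ^ length L"
  define \<delta> where "\<delta> = (\<epsilon> / (\<bar>Z\<bar> + 1)) powr (1 / q)"
  have \<delta>0: "0 < \<delta>" using \<epsilon> by (simp add: \<delta>_def)
  have "\<delta> powr q = \<epsilon> / (\<bar>Z\<bar> + 1)"
    using q \<epsilon> unfolding \<delta>_def powr_powr by simp
  moreover have "\<epsilon> / (\<bar>Z\<bar> + 1) * Z \<le> \<epsilon> / (\<bar>Z\<bar> + 1) * (\<bar>Z\<bar> + 1)"
    using \<epsilon> by (intro mult_left_mono) auto
  ultimately have \<delta>Z: "\<delta> powr q * Z \<le> \<epsilon>" by simp
  obtain N where N: "0 \<le> N" "\<And>t. N \<le> t \<Longrightarrow> \<omega> N t \<le> \<delta>" by (rule tail[OF \<delta>0]) blast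
  define \<omega>' where "\<omega>' s t = \<omega> s t + \<omega> (max s N) (max t N) / \<delta>" for s t
  have tail_nonneg: "0 \<le> \<omega> (max s N) (max t N) / \<delta>" if "0 \<le> s" "s \<le> t" for s t
    using that N(1) \<delta>0 by (intro divide_nonneg_pos nonneg) auto
  interpret c: control \<omega>' q "W + 1"
  proof
    fix s t :: real assume st: "0 \<le> s" "s \<le> t"
    show "0 \<le> \<omega>' s t" using nonneg[OF st] tail_nonneg[OF st] by (simp add: \<omega>'_def)
    have "\<omega> (max s N) (max t N) \<le> \<omega> N (max t N)" using st N(1) by (intro mono) auto
    also have "\<dots> \<le> \<delta>" by (intro N(2)) simp
    finally show "\<omega>' s t \<le> W + 1" using bound[OF st] \<delta>0 by (auto simp: \<omega>'_def intro!: add_mono)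
  next
    fix s u t :: real assume sut: "0 \<le> s" "s \<le> u" "u \<le> t"
    have "\<omega> (max s N) (max u N) + \<omega> (max u N) (max t N) \<le> \<omega> (max s N) (max t N)"
      using sut N(1) by (intro super) auto
    then have "(\<omega> (max s N) (max u N) + \<omega> (max u N) (max t N)) / \<delta> \<le> \<omega> (max s N) (max t N) / \<delta>"
      using \<delta>0 by (intro divide_right_mono) auto
    then show "\<omega>' s u + \<omega>' u t \<le> \<omega>' s t"
      using super[OF sut] by (simp add: \<omega>'_def add_divide_distrib)
  qed (rule q)
  have le': "\<omega> s t \<le> \<omega>' s t" if "0 \<le> s" "s \<le> t" for s t
    using tail_nonneg[OF that] by (simp add: \<omega>'_def)
  have powr_le: "x powr q \<le> y powr q" if "0 \<le> x" "x \<le> y" for x y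
    using that q by (intro powr_mono2) auto
  show thesis
  proof (rule that[OF N(1)])
    fix D D' :: "nat \<Rightarrow> real" and t :: real
    assume t: "0 \<le> t" and DN: "\<And>i. i \<in> set L \<Longrightarrow> N \<le> D i \<and> N \<le> D' i"
    have driven: "c.driven a (\<lambda>x. g i x * indicator {..<d} x)" if i: "i \<in> set L" for i d
      unfolding c.driven_def
    proof (intro conjI allI impI int[OF i])
      fix s t :: real assume st: "0 \<le> s" "s \<le> t"
      show "norm (incr (\<lambda>x. g i x * indicator {..<d} x) s t) \<le> a * \<omega>' s t powr q"
      proof (cases "s \<le> min t d")
        case True
        have "norm (incr (\<lambda>x. g i x * indicator {..<d} x) s t) \<le> a * \<omega> s (min t d) powr q"
          unfolding incr_cut by (rule g[OF i st(1) True])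
        also have "\<dots> \<le> a * \<omega>' s t powr q"
          using order.trans[OF mono[OF st(1) order_refl True min.cobounded1] le'[OF st]] nonneg[OF st(1) True]
          by (intro mult_left_mono powr_le a)
        finally show ?thesis .
      next
        case False
        then have "min t d \<le> s" by linarith
        then show ?thesis unfolding incr_cut using a by simp
      qed
    qed
    have diff: "norm (incr (\<lambda>x. g i x * indicator {..<d} x - g i x * indicator {..<d'} x) s t)
        \<le> \<delta> powr q * a * \<omega>' s t powr q"
      if i: "i \<in> set L" and d: "N \<le> d" "d \<le> d'" and st: "0 \<le> s" "s \<le> t" for i d d' s t
    proof (cases "max s d \<le> min t d'")
      case True
      have "norm (incr (\<lambda>x. g i x * indicator {..<d} x - g i x * indicator {..<d'} x) s t)
          = norm (incr (g i) (max s d) (min t d'))"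
        unfolding incr_cut_diff[OF d(2)] by (rule norm_minus_cancel)
      also have "\<dots> \<le> a * \<omega> (max s d) (min t d') powr q"
        using st by (intro g[OF i _ True]) auto
      \<comment> \<open>The interval lies beyond \<open>N\<close>, so its control is at most
        \<open>\<delta>\<close> times the rescaled tail contained in
        \<open>\<omega>'\<close>.\<close>
      also have "\<dots> \<le> a * (\<delta> * \<omega>' s t) powr q"
      proof (intro mult_left_mono powr_le a)
        show "0 \<le> \<omega> (max s d) (min t d')" using st True by (intro nonneg) auto
        have "\<omega> (max s d) (min t d') \<le> \<omega> (max s N) (max t N)"
          using st d N(1) True by (intro mono) auto
        also have "\<dots> = \<delta> * (\<omega> (max s N) (max t N) / \<delta>)" using \<delta>0 by simp
        also have "\<dots> \<le> \<delta> * \<omega>' s t"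
          using nonneg[OF st] \<delta>0 by (intro mult_left_mono) (auto simp: \<omega>'_def)
        finally show "\<omega> (max s d) (min t d') \<le> \<delta> * \<omega>' s t" .
      qed
      also have "\<dots> = \<delta> powr q * a * \<omega>' s t powr q"
        using \<delta>0 c.nonneg[OF st] by (simp add: powr_mult)
      finally show ?thesis .
    next
      case False
      then have "min t d' \<le> max s d" by linarith
      then have "incr (\<lambda>x. g i x * indicator {..<d} x - g i x * indicator {..<d'} x) s t = 0"
        unfolding incr_cut_diff[OF d(2)] by (simp only: incr_empty minus_zero)
      then show ?thesis using a by simp
    qed
    have driven_diff: "c.driven (\<delta> powr q * a) (\<lambda>x. g i x * indicator {..<D i} x - g i x * indicator {..<D' i} x)"
      if i: "i \<in> set L" for i
      unfolding c.driven_def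
    proof (intro conjI allI impI Bochner_Integration.integrable_diff int[OF i])
      fix s t :: real assume st: "0 \<le> s" "s \<le> t"
      show "norm (incr (\<lambda>x. g i x * indicator {..<D i} x - g i x * indicator {..<D' i} x) s t)
          \<le> \<delta> powr q * a * \<omega>' s t powr q"
      proof (cases "D i \<le> D' i")
        case True
        then show ?thesis using DN[OF i] by (intro diff[OF i _ _ st]) auto
      next
        case False
        have "norm (incr (\<lambda>x. g i x * indicator {..<D' i} x - g i x * indicator {..<D i} x) s t)
            \<le> \<delta> powr q * a * \<omega>' s t powr q"
          using False DN[OF i] by (intro diff[OF i _ _ st]) auto
        then show ?thesis
          unfolding incr_minus[OF int[OF i] int[OF i]] by (simp only: norm_minus_commute)
      qed
    qed
    have "c.controlled (\<delta> powr q * length L * (c.K * a) ^ length L)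
       (\<lambda>t. iter (\<lambda>i x. g i x * indicator {..<D i} x) L t - iter (\<lambda>i x. g i x * indicator {..<D' i} x) L t)"
      by (rule c.controlled_iter_diff[OF driven driven driven_diff a]) auto
    then have "norm (iter (\<lambda>i x. g i x * indicator {..<D i} x) L t - iter (\<lambda>i x. g i x * indicator {..<D' i} x) L t)
        \<le> \<delta> powr q * length L * (c.K * a) ^ length L"
      using t unfolding c.controlled_def by blast
    also have "\<dots> = \<delta> powr q * Z" by (simp add: Z_def)
    also have "\<dots> \<le> \<epsilon>" by (rule \<delta>Z)
    finally show "norm (iter (\<lambda>i x. g i x * indicator {..<D i} x) L t - iter (\<lambda>i x. g i x * indicator {..<D' i} x) L t) \<le> \<epsilon>" .
  qed
qed

end

text \<open>Each function comes with its own control; the sum serves for all of them at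
  once.\<close>

lemma control_sum:
  assumes J: "finite J" "J \<noteq> {}" and c: "\<And>i. i \<in> J \<Longrightarrow> control (\<omega> i) q (W i)"
  shows "control (\<lambda>s t. \<Sum>i\<in>J. \<omega> i s t) q (\<Sum>i\<in>J. W i)"
proof
  fix s t :: real assume st: "0 \<le> s" "s \<le> t"
  show "0 \<le> (\<Sum>i\<in>J. \<omega> i s t)" using control.nonneg[OF c st] by (intro sum_nonneg)
  show "(\<Sum>i\<in>J. \<omega> i s t) \<le> (\<Sum>i\<in>J. W i)" using control.bound[OF c st] by (intro sum_mono)
next
  fix s u t :: real assume sut: "0 \<le> s" "s \<le> u" "u \<le> t"
  show "(\<Sum>i\<in>J. \<omega> i s u) + (\<Sum>i\<in>J. \<omega> i u t) \<le> (\<Sum>i\<in>J. \<omega> i s t)"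
    unfolding sum.distrib[symmetric] using control.super[OF c sut] by (intro sum_mono)
next
  show "1/2 < q" using J(2) control.q[OF c] by blast
qed

lemma multilinear_op_convergent:
  assumes A: "A \<subseteq> {1..n} \<times> {1..n}"
    and int: "\<And>i D. i \<in> {1..n} \<Longrightarrow> integrable halfline (\<lambda>x. f i x * k i l x * indicator {..<D} x)"
    and ctl: "control \<omega> q W" and a: "0 \<le> a"
    and g: "\<And>i s t. i \<in> {1..n} \<Longrightarrow> 0 \<le> s \<Longrightarrow> s \<le> t \<Longrightarrow>
        norm (incr (\<lambda>x. f i x * k i l x) s t) \<le> a * \<omega> s t powr q"
  shows "\<exists>T. \<forall>\<delta>>0. \<exists>N. \<forall>D. (\<forall>i\<in>{1..n}. N \<le> D i) \<longrightarrow> norm (T - multilinear_op n A k D f l) < \<delta>"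
proof -
  interpret control \<omega> q W by (rule ctl)
  let ?O = "orderings {1..n}" and ?S = "\<lambda>D. multilinear_op n A k D f l"
  let ?it = "\<lambda>D. iter (\<lambda>i x. f i x * k i l x * indicator {..<D i} x)"
  have fO: "finite ?O" by (rule finite_orderings) simp
  have Cauchy: "\<exists>N. \<forall>D D'. (\<forall>i\<in>{1..n}. N \<le> D i) \<longrightarrow> (\<forall>i\<in>{1..n}. N \<le> D' i) \<longrightarrow> norm (?S D - ?S D') < \<delta>"
    if \<delta>: "0 < \<delta>" for \<delta>
  proof -
    define \<epsilon> where "\<epsilon> = \<delta> / (card ?O + 1)"
    have \<epsilon>: "0 < \<epsilon>" "card ?O * \<epsilon> < \<delta>" using \<delta> by (auto simp: \<epsilon>_def field_simps)
    define Q where "Q L N \<longleftrightarrow> 0 \<le> N \<and>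
      (\<forall>D D' t. 0 \<le> t \<longrightarrow> (\<forall>i\<in>{1..n}. N \<le> D i \<and> N \<le> D' i) \<longrightarrow> norm (?it D L t - ?it D' L t) \<le> \<epsilon>)"
      for L N
    have "\<exists>N. Q L N" if L: "L \<in> ?O" for L
    proof -
      have sL: "set L = {1..n}" using L unfolding orderings_def by blast
      show ?thesis
      proof (rule iter_cut_Cauchy[of L "\<lambda>i x. f i x * k i l x" a \<epsilon>])
        fix N :: real
        assume "0 \<le> N" and N: "\<And>D D' t. 0 \<le> t \<Longrightarrow> (\<And>i. i \<in> set L \<Longrightarrow> N \<le> D i \<and> N \<le> D' i) \<Longrightarrow>
            norm (?it D L t - ?it D' L t) \<le> \<epsilon>"
        show ?thesis unfolding Q_def
        proof (intro exI[of _ N] conjI allI impI)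
          fix D D' :: "nat \<Rightarrow> real" and t :: real
          assume "0 \<le> t" "\<forall>i\<in>{1..n}. N \<le> D i \<and> N \<le> D' i"
          then show "norm (?it D L t - ?it D' L t) \<le> \<epsilon>" by (intro N) (simp_all add: sL)
        qed fact
      next
        show "integrable halfline (\<lambda>x. f i x * k i l x * indicator {..<D} x)" if "i \<in> set L" for i D
          by (rule int) (use that sL in simp)
        show "norm (incr (\<lambda>x. f i x * k i l x) s t) \<le> a * \<omega> s t powr q"
          if "i \<in> set L" "0 \<le> s" "s \<le> t" for i s t
          by (rule g[OF _ that(2,3)]) (use that sL in simp)
      qed (rule a \<epsilon>(1))+
    qed
    then obtain N where "\<And>L. L \<in> ?O \<Longrightarrow> Q L (N L)" by metis
    then have N: "\<And>L. L \<in> ?O \<Longrightarrow> 0 \<le> N L"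
      "\<And>L D D' t. L \<in> ?O \<Longrightarrow> 0 \<le> t \<Longrightarrow> \<forall>i\<in>{1..n}. N L \<le> D i \<and> N L \<le> D' i \<Longrightarrow> norm (?it D L t - ?it D' L t) \<le> \<epsilon>"
      unfolding Q_def by blast+
    \<comment> \<open>The thresholds are nonnegative, so their sum is above each of them.\<close>
    define N0 where "N0 = (\<Sum>L\<in>?O. N L)"
    have N0: "N L \<le> N0" if "L \<in> ?O" for L
      unfolding N0_def using that N(1) fO by (intro member_le_sum) auto
    show ?thesis
    proof (intro exI[of _ N0] allI impI)
      fix D D' :: "nat \<Rightarrow> real" assume D: "\<forall>i\<in>{1..n}. N0 \<le> D i" "\<forall>i\<in>{1..n}. N0 \<le> D' i"
      \<comment> \<open>A common ceiling for both systems of cut-offs. It varies with them, which is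
        harmless because the bound on the iterated integrals is uniform in \<open>t\<close>.\<close>
      define t where "t = (\<Sum>i\<in>{1..n}. \<bar>D i\<bar> + \<bar>D' i\<bar>)"
      have ti: "\<bar>D i\<bar> + \<bar>D' i\<bar> \<le> t" if "i \<in> {1..n}" for i
        unfolding t_def using that by (intro member_le_sum) auto
      have t: "0 \<le> t" "\<And>i. i \<in> {1..n} \<Longrightarrow> D i \<le> t" "\<And>i. i \<in> {1..n} \<Longrightarrow> D' i \<le> t"
      proof -
        show "0 \<le> t" unfolding t_def by (intro sum_nonneg) simp
        show "D i \<le> t" "D' i \<le> t" if "i \<in> {1..n}" for i using ti[OF that] by linarith+
      qed
      have S: "?S D = (\<Sum>L\<in>?O. of_bool (extends A L) * ?it D L t)"
        if "\<And>i. i \<in> {1..n} \<Longrightarrow> D i \<le> t" for D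
        by (rule multilinear_op_eq_sum_iter[where D=D and f=f and k=k and l=l and t=t, OF A int that])
      have diff: "?S D - ?S D' = (\<Sum>L\<in>?O. of_bool (extends A L) * (?it D L t - ?it D' L t))"
        using arg_cong2[where f="(-)", OF S[OF t(2)] S[OF t(3)]]
        by (simp only: sum_subtractf right_diff_distrib)
      have "norm (?S D - ?S D') \<le> (\<Sum>L\<in>?O. \<epsilon>)"
        unfolding diff
      proof (rule sum_norm_le)
        fix L assume L: "L \<in> ?O"
        have "\<forall>i\<in>{1..n}. N L \<le> D i \<and> N L \<le> D' i"
          using D N0[OF L] by (meson order.trans)
        then have "norm (?it D L t - ?it D' L t) \<le> \<epsilon>" by (rule N(2)[OF L t(1)])
        then show "norm (of_bool (extends A L) * (?it D L t - ?it D' L t)) \<le> \<epsilon>"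
          using \<epsilon>(1) by (cases "extends A L") simp_all
      qed
      then show "norm (?S D - ?S D') < \<delta>" using \<epsilon>(2) by simp
    qed
  qed
  \<comment> \<open>The limit is taken along equal integer cut-offs; the Cauchy bound, uniform in
    both arguments, then compares it with arbitrary ones.\<close>
  define s where "s m = ?S (\<lambda>_. real m)" for m
  have "Cauchy s"
  proof (rule CauchyI)
    fix e :: real assume "0 < e"
    then obtain N where N: "\<And>D D'. \<forall>i\<in>{1..n}. N \<le> D i \<Longrightarrow> \<forall>i\<in>{1..n}. N \<le> D' i \<Longrightarrow> norm (?S D - ?S D') < e"
      using Cauchy by blast
    show "\<exists>M. \<forall>m\<ge>M. \<forall>m'\<ge>M. norm (s m - s m') < e"
    proof (intro exI[of _ "nat \<lceil>N\<rceil>"] allI impI)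
      fix m m' assume "nat \<lceil>N\<rceil> \<le> m" "nat \<lceil>N\<rceil> \<le> m'"
      then have "N \<le> real m" "N \<le> real m'" by linarith+
      then show "norm (s m - s m') < e" unfolding s_def by (intro N) auto
    qed
  qed
  then obtain T where T: "s \<longlonglongrightarrow> T" using Cauchy_convergent convergent_def by blast
  show ?thesis
  proof (intro exI[of _ T] allI impI)
    fix \<delta> :: real assume \<delta>: "0 < \<delta>"
    then obtain N where N: "\<And>D D'. \<forall>i\<in>{1..n}. N \<le> D i \<Longrightarrow> \<forall>i\<in>{1..n}. N \<le> D' i \<Longrightarrow> norm (?S D - ?S D') < \<delta> / 2"
      using Cauchy[OF half_gt_zero[OF \<delta>]] by blast
    show "\<exists>N. \<forall>D. (\<forall>i\<in>{1..n}. N \<le> D i) \<longrightarrow> norm (T - ?S D) < \<delta>"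
    proof (intro exI[of _ N] allI impI)
      fix D :: "nat \<Rightarrow> real" assume D: "\<forall>i\<in>{1..n}. N \<le> D i"
      have "(\<lambda>m. norm (s m - ?S D)) \<longlonglongrightarrow> norm (T - ?S D)"
        by (intro tendsto_intros T)
      moreover have "\<exists>M. \<forall>m\<ge>M. norm (s m - ?S D) \<le> \<delta> / 2"
      proof (intro exI[of _ "nat \<lceil>N\<rceil>"] allI impI)
        fix m assume "nat \<lceil>N\<rceil> \<le> m"
        then have "N \<le> real m" by linarith
        then show "norm (s m - ?S D) \<le> \<delta> / 2" unfolding s_def using D by (intro less_imp_le N) auto
      qed
      ultimately have "norm (T - ?S D) \<le> \<delta> / 2" by (rule LIMSEQ_le_const2)
      then show "norm (T - ?S D) < \<delta>" using \<delta> by simp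
    qed
  qed
qed

theorem theorem5p3:
  fixes n :: nat and I :: "real set" and k :: "nat \<Rightarrow> real \<Rightarrow> real \<Rightarrow> complex"
    and C :: "nat \<Rightarrow> real" and A :: "(nat \<times> nat) set"
    and p :: real and f :: "nat \<Rightarrow> real \<Rightarrow> complex"
  assumes "n \<ge> 2"
    and "I \<in> sets lebesgue"
    and "\<And>i. i \<in> {1..n} \<Longrightarrow>
           (\<lambda>(l, x). k i l x) \<in> borel_measurable (lebesgue_on (I \<times> {0<..}))"
    and "\<And>i. i \<in> {1..n} \<Longrightarrow> bounded ((\<lambda>(l, x). k i l x) ` (I \<times> {0<..}))"
    and "\<And>i g. i \<in> {1..n} \<Longrightarrow> g \<in> Lp_space 2 {0<..} \<Longrightarrow> compactly_supported_in {0<..} g \<Longrightarrow>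
           kernel_op (k i) g \<in> Lp_space 2 I \<and>
           Lp_norm 2 I (kernel_op (k i) g) \<le> C i * Lp_norm 2 {0<..} g"
    and "A \<subseteq> {1..n} \<times> {1..n}"
    and "1 \<le> p" and "p < 2"
    and "\<And>i. i \<in> {1..n} \<Longrightarrow> f i \<in> Lp_space p {0<..}"
  shows "AE l in lebesgue_on I. \<exists>Tinf::complex. \<forall>\<delta>>0. \<exists>N::real. \<forall>D.
           (\<forall>i\<in>{1..n}. 0 < D i) \<and> N \<le> Min (D ` {1..n}) \<longrightarrow>
           norm (Tinf - multilinear_op n A k D f l) < \<delta>"
proof -
  \<comment> \<open>The variation exponent \<open>1 / q\<close> is the midpoint of \<open>p\<close>
    and 2.\<close>
  define q where "q = 2 / (p + 2)"
  have q: "1/2 < q" "p * q < 1" using assms(7,8) by (auto simp: q_def field_simps)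
  define P where "P i l a \<omega> W \<longleftrightarrow> 0 \<le> a \<and> control \<omega> q W \<and>
    (\<forall>s t. 0 \<le> s \<longrightarrow> s \<le> t \<longrightarrow> norm (incr (\<lambda>x. f i x * k i l x) s t) \<le> a * \<omega> s t powr q)"
    for i l a W and \<omega> :: "real \<Rightarrow> real \<Rightarrow> real"
  have "AE l in lebesgue_on I. \<forall>i\<in>{1..n}.
      (\<forall>D. integrable halfline (\<lambda>x. f i x * k i l x * indicator {..<D} x)) \<and> (\<exists>a \<omega> W. P i l a \<omega> W)"
  proof (rule AE_finite_allI)
    fix i assume i: "i \<in> {1..n}"
    show "AE l in lebesgue_on I.
        (\<forall>D. integrable halfline (\<lambda>x. f i x * k i l x * indicator {..<D} x)) \<and> (\<exists>a \<omega> W. P i l a \<omega> W)"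
      unfolding P_def
      by (rule AE_control[OF assms(2) assms(3)[OF i] assms(4)[OF i] assms(5)[OF i] assms(7) _ assms(9)[OF i] q])
         (use assms(8) in simp_all)
  qed simp
  then show ?thesis
  proof eventually_elim
    case (elim l)
    then obtain a \<omega> W where P: "\<And>i. i \<in> {1..n} \<Longrightarrow> P i l (a i) (\<omega> i) (W i)" by metis
    have a0: "0 \<le> a i" and ctl: "control (\<omega> i) q (W i)"
      and inc: "\<And>s t. 0 \<le> s \<Longrightarrow> s \<le> t \<Longrightarrow> norm (incr (\<lambda>x. f i x * k i l x) s t) \<le> a i * \<omega> i s t powr q"
      if "i \<in> {1..n}" for i
      using P[OF that] by (auto simp: P_def)
    have ne: "{1..n} \<noteq> {}" using assms(1) by auto
    have csum: "control (\<lambda>s t. \<Sum>i\<in>{1..n}. \<omega> i s t) q (\<Sum>i\<in>{1..n}. W i)"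
      by (rule control_sum[OF _ ne ctl]) simp
    have "\<exists>T. \<forall>\<delta>>0. \<exists>N. \<forall>D. (\<forall>i\<in>{1..n}. N \<le> D i) \<longrightarrow> norm (T - multilinear_op n A k D f l) < \<delta>"
    proof (rule multilinear_op_convergent[OF assms(6) _ csum])
      show "0 \<le> (\<Sum>i\<in>{1..n}. a i)" by (intro sum_nonneg a0)
      show "integrable halfline (\<lambda>x. f i x * k i l x * indicator {..<D} x)" if "i \<in> {1..n}" for i D
        using elim that by blast
      fix i s t assume i: "i \<in> {1..n}" and st: "(0::real) \<le> s" "s \<le> t"
      have "norm (incr (\<lambda>x. f i x * k i l x) s t) \<le> a i * \<omega> i s t powr q" by (rule inc[OF i st])
      also have "\<dots> \<le> (\<Sum>i\<in>{1..n}. a i) * (\<Sum>i\<in>{1..n}. \<omega> i s t) powr q"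
      proof (intro mult_mono powr_mono2)
        show "a i \<le> (\<Sum>i\<in>{1..n}. a i)" using i a0 by (intro member_le_sum) auto
        show "\<omega> i s t \<le> (\<Sum>i\<in>{1..n}. \<omega> i s t)"
          using i control.nonneg[OF ctl st] by (intro member_le_sum) auto
        show "0 \<le> \<omega> i s t" by (rule control.nonneg[OF ctl[OF i] st])
        show "0 \<le> (\<Sum>i\<in>{1..n}. a i)" by (intro sum_nonneg a0)
      qed (use q in simp_all)
      finally show "norm (incr (\<lambda>x. f i x * k i l x) s t) \<le> (\<Sum>i\<in>{1..n}. a i) * (\<Sum>i\<in>{1..n}. \<omega> i s t) powr q" .
    qed
    then obtain T where T: "\<And>\<delta>. 0 < \<delta> \<Longrightarrow>
        \<exists>N. \<forall>D. (\<forall>i\<in>{1..n}. N \<le> D i) \<longrightarrow> norm (T - multilinear_op n A k D f l) < \<delta>" by blast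
    show ?case
    proof (intro exI[of _ T] allI impI)
      fix \<delta> :: real assume "0 < \<delta>"
      then obtain N where N: "\<And>D. \<forall>i\<in>{1..n}. N \<le> D i \<Longrightarrow> norm (T - multilinear_op n A k D f l) < \<delta>"
        using T by blast
      show "\<exists>N. \<forall>D. (\<forall>i\<in>{1..n}. 0 < D i) \<and> N \<le> Min (D ` {1..n}) \<longrightarrow>
          norm (T - multilinear_op n A k D f l) < \<delta>"
      proof (intro exI[of _ N] allI impI)
        fix D :: "nat \<Rightarrow> real" assume "(\<forall>i\<in>{1..n}. 0 < D i) \<and> N \<le> Min (D ` {1..n})"
        then have "\<forall>i\<in>{1..n}. N \<le> D i" using ne by simp
        then show "norm (T - multilinear_op n A k D f l) < \<delta>" by (rule N)
      qed
    qed
  qed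
qed

end
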